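(* Let $f\colon\widehat{\mathbb{C}}\to\widehat{\mathbb{C}}$ be a hyperbolic, postcritically finite rational map of degree at least $2$ with $\#\operatorname{post}(f)=3$ that is not a polynomial. Then $f$ does not arise as a mating.
   Context: $f$ is hyperbolic if every critical point lies in the Fatou set. "Not a polynomial" means there is no point $\infty$ with $f^{-1}(\infty)=\{\infty\}$ (no totally invariant point). Topological mating: Let $P$ be a monic polynomial of degree $d$ with connected, locally connected filled Julia set $\mathcal{K}$; the Riemann map $\phi\colon\widehat{\mathbb{C}}\setminus\overline{\mathbb{D}}\to\widehat{\mathbb{C}}\setminus\mathcal{K}$ with $\phi(\infty)=\infty$, $\phi'(\infty)>0$ extends continuously to $\sigma\colon\mathbb{R}/\mathbb{Z}\to\partial\mathcal{K}$ (using $t\mapsto e^{2\pi it}$). For two such monic polynomials $P_{\tt w},P_{\tt b}$ of the same degree, $\mathcal{K}_{\tt w}\perp\!\!\!\perp\mathcal{K}_{\tt b}$ is the quotient of $\mathcal{K}_{\tt w}\sqcup\mathcal{K}_{\tt b}$ by the equivalence relation generated by $\sigma_{\tt w}(t)\sim\sigma_{\tt b}(-t)$, and the topological mating is the induced map, equal to $P_{\tt w}$ on $\mathcal{K}_{\tt w}$ and $P_{\tt b}$ on $\mathcal{K}_{\tt b}$. $f$ arises as a mating if it is topologically conjugate to such a topological mating of two postcritically finite monic polynomials. *)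

theory Defs
  imports "HOL-Analysis.Analysis" "HOL-Computational_Algebra.Polynomial"
begin

text \<open>The Riemann sphere is modelled as the type complex option (None is the point at
infinity), equipped with the chordal metric.\<close>

fun chordal :: "complex option \<Rightarrow> complex option \<Rightarrow> real" where
  "chordal (Some z) (Some w) = 2 * cmod (z - w) / (sqrt (1 + (cmod z)^2) * sqrt (1 + (cmod w)^2))"
| "chordal (Some z) None = 2 / sqrt (1 + (cmod z)^2)"
| "chordal None (Some w) = 2 / sqrt (1 + (cmod w)^2)"
| "chordal None None = 0"

definition sphere_top :: "complex option topology" where
  "sphere_top = Metric_space.mtopology UNIV chordal"

fun rat_eval :: "complex poly \<Rightarrow> complex poly \<Rightarrow> complex option \<Rightarrow> complex option" where
  "rat_eval p q (Some z) = (if poly q z = 0 then None else Some (poly p z / poly q z))"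
| "rat_eval p q None = (if degree p > degree q then None else Some (coeff p (degree q) / lead_coeff q))"

definition rational_map_of_degree :: "(complex option \<Rightarrow> complex option) \<Rightarrow> nat \<Rightarrow> bool" where
  "rational_map_of_degree f d \<longleftrightarrow>
     (\<exists>p q. q \<noteq> 0 \<and> coprime p q \<and> max (degree p) (degree q) = d \<and> f = rat_eval p q)"

text \<open>Local coordinates: chart_in a maps a neighbourhood of 0 onto a neighbourhood of a,
chart_out b maps a neighbourhood of b onto a neighbourhood of 0.\<close>
fun chart_in :: "complex option \<Rightarrow> complex \<Rightarrow> complex option" where
  "chart_in (Some z) w = Some (z + w)"
| "chart_in None w = (if w = 0 then None else Some (1 / w))"

fun chart_out :: "complex option \<Rightarrow> complex option \<Rightarrow> complex" where
  "chart_out (Some u) x = (case x of Some v \<Rightarrow> v - u | None \<Rightarrow> 0)"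
| "chart_out None x = (case x of Some v \<Rightarrow> 1 / v | None \<Rightarrow> 0)"

definition critical_point :: "(complex option \<Rightarrow> complex option) \<Rightarrow> complex option \<Rightarrow> bool" where
  "critical_point f a \<longleftrightarrow> deriv (\<lambda>w. chart_out (f a) (f (chart_in a w))) 0 = 0"

definition post :: "(complex option \<Rightarrow> complex option) \<Rightarrow> complex option set" where
  "post f = {(f ^^ n) c | n c. n \<ge> 1 \<and> critical_point f c}"

definition postcritically_finite :: "(complex option \<Rightarrow> complex option) \<Rightarrow> bool" where
  "postcritically_finite f \<longleftrightarrow> finite (post f)"

definition fatou_set :: "(complex option \<Rightarrow> complex option) \<Rightarrow> complex option set" where
  "fatou_set f = {z. \<forall>e>0. \<exists>\<delta>>0. \<forall>w. chordal z w < \<delta> \<longrightarrow>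
                      (\<forall>n. chordal ((f ^^ n) z) ((f ^^ n) w) < e)}"

definition hyperbolic :: "(complex option \<Rightarrow> complex option) \<Rightarrow> bool" where
  "hyperbolic f \<longleftrightarrow> (\<forall>c. critical_point f c \<longrightarrow> c \<in> fatou_set f)"

definition is_polynomial_like :: "(complex option \<Rightarrow> complex option) \<Rightarrow> bool" where
  "is_polynomial_like f \<longleftrightarrow> (\<exists>a. f -` {a} = {a})"

definition filled_julia :: "complex poly \<Rightarrow> complex set" where
  "filled_julia P = {z. bounded (range (\<lambda>n. (poly P ^^ n) z))}"

text \<open>Phi is the Riemann map of the complement of the filled Julia set on |z| > 1,
normalised with phi(infinity) = infinity and phi'(infinity) > 0, extended continuously to |z| >= 1.
The boundary map is sigma(t) = Phi(exp(2 pi i t)).\<close>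
definition riemann_map_ext :: "complex poly \<Rightarrow> (complex \<Rightarrow> complex) \<Rightarrow> bool" where
  "riemann_map_ext P \<Phi> \<longleftrightarrow>
     \<Phi> holomorphic_on {z. 1 < cmod z} \<and>
     inj_on \<Phi> {z. 1 < cmod z} \<and>
     \<Phi> ` {z. 1 < cmod z} = - filled_julia P \<and>
     (\<exists>c::real. c > 0 \<and> ((\<lambda>z. \<Phi> z / z) \<longlongrightarrow> complex_of_real c) at_infinity) \<and>
     continuous_on {z. 1 \<le> cmod z} \<Phi>"

definition boundary_param :: "(complex \<Rightarrow> complex) \<Rightarrow> real \<Rightarrow> complex" where
  "boundary_param \<Phi> t = \<Phi> (exp (2 * pi * \<i> * complex_of_real t))"

text \<open>Disjoint union K_w + K_b, encoded as pairs (True, z) (white) and (False, z) (black).\<close>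
definition mating_space :: "complex poly \<Rightarrow> complex poly \<Rightarrow> (bool \<times> complex) set" where
  "mating_space Pw Pb = Sigma UNIV (\<lambda>i. if i then filled_julia Pw else filled_julia Pb)"

definition mating_top :: "complex poly \<Rightarrow> complex poly \<Rightarrow> (bool \<times> complex) topology" where
  "mating_top Pw Pb = sum_topology
     (\<lambda>i. subtopology euclidean (if i then filled_julia Pw else filled_julia Pb)) UNIV"

definition mating_map :: "complex poly \<Rightarrow> complex poly \<Rightarrow> bool \<times> complex \<Rightarrow> bool \<times> complex" where
  "mating_map Pw Pb x = (fst x, poly (if fst x then Pw else Pb) (snd x))"

definition mating_rel :: "complex poly \<Rightarrow> complex poly \<Rightarrow> (complex \<Rightarrow> complex) \<Rightarrow> (complex \<Rightarrow> complex)
     \<Rightarrow> ((bool \<times> complex) \<times> (bool \<times> complex)) set" where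
  "mating_rel Pw Pb \<Phi>w \<Phi>b =
     (let R = {((True, boundary_param \<Phi>w t), (False, boundary_param \<Phi>b (- t))) | t. True}
      in Id_on (mating_space Pw Pb) \<union> (R \<union> R\<inverse>)\<^sup>+)"

definition pcf_polynomial :: "complex poly \<Rightarrow> bool" where
  "pcf_polynomial P \<longleftrightarrow> postcritically_finite (rat_eval P 1)"

text \<open>f arises as a mating: f is topologically conjugate to the topological mating of two
postcritically finite monic polynomials of the same degree. The homeomorphism from the
quotient space onto the sphere is expressed as a quotient map pi from K_w + K_b onto the
sphere whose fibres are exactly the equivalence classes.\<close>
definition arises_as_mating :: "(complex option \<Rightarrow> complex option) \<Rightarrow> bool" where
  "arises_as_mating f \<longleftrightarrow>
    (\<exists>Pw Pb \<Phi>w \<Phi>b \<pi>.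
       degree Pw = degree Pb \<and> degree Pw \<ge> 2 \<and>
       lead_coeff Pw = 1 \<and> lead_coeff Pb = 1 \<and>
       pcf_polynomial Pw \<and> pcf_polynomial Pb \<and>
       connected (filled_julia Pw) \<and> locally_connected_space (subtopology euclidean (filled_julia Pw)) \<and>
       connected (filled_julia Pb) \<and> locally_connected_space (subtopology euclidean (filled_julia Pb)) \<and>
       riemann_map_ext Pw \<Phi>w \<and> riemann_map_ext Pb \<Phi>b \<and>
       quotient_map (mating_top Pw Pb) sphere_top \<pi> \<and>
       (\<forall>x\<in>mating_space Pw Pb. \<forall>y\<in>mating_space Pw Pb.
           \<pi> x = \<pi> y \<longleftrightarrow> (x, y) \<in> mating_rel Pw Pb \<Phi>w \<Phi>b) \<and>
       (\<forall>x\<in>mating_space Pw Pb. \<pi> (mating_map Pw Pb x) = f (\<pi> x)))"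

end

theory Submission
  imports Defs "HOL-Complex_Analysis.Complex_Analysis"
    "HOL-Computational_Algebra.Fundamental_Theorem_Algebra"
begin

text \<open>
  Suppose that \<open>f\<close> is a mating of \<open>P\<^sub>w\<close> and \<open>P\<^sub>b\<close>. The common image \<open>\<gamma>\<close> of the two Julia sets is a
  curve along which \<open>f\<close> acts as multiplication by the degree \<open>d\<close> on the circle; by expansion \<open>\<gamma>\<close> misses the Fatou
  set, unless it is a single point, which would then be totally invariant. Hence every postcritical
  point of \<open>f\<close> lies in the image of the interior of one of the filled Julia sets. There the quotient
  map is injective, so the fibre of \<open>f\<close> over such a point has the cardinality of the corresponding
  fibre of \<open>P\<^sub>w\<close> or \<open>P\<^sub>b\<close>.

  By Riemann-Hurwitz, the numbers \<open>d - card (f -` {v})\<close> sum up to \<open>2d - 2\<close> over the postcritical set,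
  while the white and the black points contribute at most \<open>d - 1\<close> each. So both contribute exactly
  \<open>d - 1 > 0\<close>, and one of the two colours has exactly one postcritical point \<open>a\<close>. Then \<open>a\<close> is
  fixed, as the postcritical set is forward invariant, and the fibre over \<open>a\<close> is a single point. Thus
  \<open>a\<close> is totally invariant.
\<close>

section \<open>Counting preimages under rational maps\<close>

lemma degree_diff_eq_left:
  fixes p q :: "'a::ab_group_add poly"
  assumes "degree q < degree p"
  shows "degree (p - q) = degree p"
  using degree_add_eq_left[of "- q" p] assms by simp

text \<open>The numerator of the derivative of \<open>p / q\<close>. For coprime \<open>p\<close>
  and \<open>q\<close> its zeros are the finite critical points of \<open>rat_eval p q\<close>,
  poles included, because exchanging \<open>p\<close> and \<open>q\<close> only changes its
  sign.\<close>

definition wronskian :: "complex poly \<Rightarrow> complex poly \<Rightarrow> complex poly" where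
  "wronskian p q = pderiv p * q - p * pderiv q"

text \<open>For coprime \<open>p\<close> and \<open>q\<close> its roots are the finite points over
  \<open>v\<close>; over infinity these are the poles.\<close>

definition fibre_poly :: "complex poly \<Rightarrow> complex poly \<Rightarrow> complex option \<Rightarrow> complex poly" where
  "fibre_poly p q v = (case v of Some u \<Rightarrow> p - smult u q | None \<Rightarrow> q)"

lemma fibre_poly_simps [simp]:
  "fibre_poly p q (Some u) = p - smult u q" "fibre_poly p q None = q"
  by (simp_all add: fibre_poly_def)

lemma wronskian_diff_smult: "wronskian (p - smult u q) q = wronskian p q"
  by (simp add: wronskian_def pderiv_diff pderiv_smult algebra_simps)

lemma wronskian_commute: "wronskian q p = - wronskian p q"
  by (simp add: wronskian_def)

text \<open>Differentiation lowers the order of \<open>r\<close> at the root by one, and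
  \<open>s\<close> does not vanish there. The term \<open>r * pderiv s\<close> is divisible by one
  more power of \<open>[:-x, 1:]\<close>, so it does not affect the order of the difference.\<close>

lemma order_wronskian:
  assumes "r \<noteq> 0" "poly r x = 0" "poly s x \<noteq> 0"
  shows "order x r = Suc (order x (wronskian r s))"
proof -
  define n where "n = order x (pderiv r)"
  have rn: "order x r = Suc n"
    using order_pderiv[OF assms(1,2)] n_def by simp
  have r'0: "pderiv r \<noteq> 0"
    using pderiv_iszero[of r] assms(1,2) by auto
  have "s \<noteq> 0" using assms(3) by auto
  then have ne: "pderiv r * s \<noteq> 0" using r'0 by simp
  have os: "order x (pderiv r * s) = n"
    using order_mult[OF ne] order_0I[OF assms(3)] n_def by simp
  have 1: "[:-x, 1:] ^ Suc n dvd r * pderiv s"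
    using order_1[of x r] rn by (metis dvd_mult2)
  have 2: "[:-x, 1:] ^ n dvd pderiv r * s" "\<not> [:-x, 1:] ^ Suc n dvd pderiv r * s"
    using order[OF ne, of x] os by auto
  have "[:-x, 1:] ^ n dvd wronskian r s"
    unfolding wronskian_def using 2(1) 1 power_le_dvd[of "[:-x, 1:]" "Suc n" _ n] by (intro dvd_diff) auto
  moreover have "\<not> [:-x, 1:] ^ Suc n dvd wronskian r s"
    unfolding wronskian_def using 2(2) 1 dvd_add[of _ "pderiv r * s - r * pderiv s" "r * pderiv s"] by auto
  ultimately have "order x (wronskian r s) = n"
    using order_unique_lemma by metis
  then show ?thesis using rn by simp
qed

lemma rat_eval_Some_eq_iff:
  assumes "coprime p q"
  shows "rat_eval p q (Some x) = v \<longleftrightarrow> poly (fibre_poly p q v) x = 0"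
proof (cases v)
  case None
  then show ?thesis by simp
next
  case (Some u)
  then show ?thesis using coprime_poly_0[OF assms, of x]
    by (auto simp: field_simps)
qed

text \<open>Local degree is one plus ramification. Coprimality keeps the other polynomial
  (\<open>p\<close> over infinity, \<open>q\<close> elsewhere) nonzero at \<open>x\<close>, and the
  symmetries of the Wronskian reduce both cases to \<open>order_wronskian\<close>.\<close>

lemma order_fibre_poly:
  assumes "coprime p q" "fibre_poly p q v \<noteq> 0" "poly (fibre_poly p q v) x = 0"
  shows "order x (fibre_poly p q v) = Suc (order x (wronskian p q))"
proof (cases v)
  case None
  then have "poly p x \<noteq> 0"
    using assms coprime_poly_0[of p q x] by auto
  then show ?thesis using order_wronskian[of q x p] assms None
    by (simp add: wronskian_commute[of q p])
next
  case (Some u)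
  have "poly q x \<noteq> 0"
    using assms coprime_poly_0[of p q x] Some by auto
  then show ?thesis using order_wronskian[of "p - smult u q" x q] assms Some
    by (simp add: wronskian_diff_smult)
qed

section \<open>Counting roots and ramification over finite sets of values\<close>

lemma sum_order_complex_poly:
  fixes p :: "complex poly"
  assumes "p \<noteq> 0"
  shows "(\<Sum>x | poly p x = 0. order x p) = degree p"
  using size_proots_complex[of p] assms by (simp add: size_multiset_overloaded_eq)

lemma degree_fibre_poly_eq_sum:
  assumes "coprime p q" "fibre_poly p q v \<noteq> 0"
  defines "F \<equiv> {x. poly (fibre_poly p q v) x = 0}"
  shows "degree (fibre_poly p q v) = card F + (\<Sum>x\<in>F. order x (wronskian p q))"
proof -
  have "degree (fibre_poly p q v) = (\<Sum>x\<in>F. Suc (order x (wronskian p q)))"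
    unfolding sum_order_complex_poly[OF assms(2), symmetric] F_def
    by (rule sum.cong) (use order_fibre_poly[OF assms(1,2)] in auto)
  then show ?thesis by (simp add: sum_Suc)
qed

text \<open>Distinct values have disjoint fibres, so each zero of the Wronskian is counted at most
  once.\<close>

lemma sum_order_fibres_le:
  assumes cop: "coprime p q" and nz: "\<And>v. v \<in> V \<Longrightarrow> fibre_poly p q v \<noteq> 0"
    and W: "wronskian p q \<noteq> 0" and V: "finite V"
  shows "(\<Sum>v\<in>V. \<Sum>x | poly (fibre_poly p q v) x = 0. order x (wronskian p q)) \<le> degree (wronskian p q)"
proof -
  let ?F = "\<lambda>v. {x. poly (fibre_poly p q v) x = 0}"
  have fin: "finite (?F v)" if "v \<in> V" for v using poly_roots_finite[OF nz[OF that]] .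
  have "(\<Sum>v\<in>V. \<Sum>x\<in>?F v. order x (wronskian p q)) = (\<Sum>x\<in>(\<Union>v\<in>V. ?F v). order x (wronskian p q))"
    by (rule sum.UNION_disjoint[symmetric]) (use V fin in \<open>auto simp: rat_eval_Some_eq_iff[OF cop, symmetric]\<close>)
  also have "\<dots> = (\<Sum>x\<in>(\<Union>v\<in>V. ?F v) \<inter> {x. poly (wronskian p q) x = 0}. order x (wronskian p q))"
    by (rule sum.mono_neutral_right) (use V fin W in \<open>auto simp: order_root\<close>)
  also have "\<dots> \<le> (\<Sum>x | poly (wronskian p q) x = 0. order x (wronskian p q))"
    by (rule sum_mono2) (use W in \<open>auto simp: poly_roots_finite\<close>)
  also have "\<dots> = degree (wronskian p q)" by (rule sum_order_complex_poly[OF W])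
  finally show ?thesis .
qed

text \<open>Here all zeros of the Wronskian lie over \<open>V\<close>, so none is missed in the
  count.\<close>

lemma sum_order_fibres_ge:
  assumes cop: "coprime p q" and nz: "\<And>v. v \<in> V \<Longrightarrow> fibre_poly p q v \<noteq> 0"
    and W: "wronskian p q \<noteq> 0" and V: "finite V"
    and crit: "\<And>x. poly (wronskian p q) x = 0 \<Longrightarrow> rat_eval p q (Some x) \<in> V"
  shows "degree (wronskian p q) \<le> (\<Sum>v\<in>V. \<Sum>x | poly (fibre_poly p q v) x = 0. order x (wronskian p q))"
proof -
  let ?F = "\<lambda>v. {x. poly (fibre_poly p q v) x = 0}"
  have fin: "finite (?F v)" if "v \<in> V" for v using poly_roots_finite[OF nz[OF that]] .
  have sub: "x \<in> (\<Union>v\<in>V. ?F v)" if "poly (wronskian p q) x = 0" for x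
    using crit[OF that] rat_eval_Some_eq_iff[OF cop, of x "rat_eval p q (Some x)"] by blast
  have "degree (wronskian p q) = (\<Sum>x | poly (wronskian p q) x = 0. order x (wronskian p q))"
    by (rule sum_order_complex_poly[OF W, symmetric])
  also have "\<dots> \<le> (\<Sum>x\<in>(\<Union>v\<in>V. ?F v). order x (wronskian p q))"
    by (rule sum_mono2) (use V fin sub in auto)
  also have "\<dots> = (\<Sum>v\<in>V. \<Sum>x\<in>?F v. order x (wronskian p q))"
    by (rule sum.UNION_disjoint) (use V fin in \<open>auto simp: rat_eval_Some_eq_iff[OF cop, symmetric]\<close>)
  finally show ?thesis .
qed

text \<open>The finite part of Riemann-Hurwitz for a polynomial, seen as the quotient
  \<open>P / 1\<close> with Wronskian \<open>pderiv P\<close>: the fibres lose at most as many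
  points as \<open>pderiv P\<close> has zeros.\<close>

lemma card_poly_fibres_ge:
  fixes P :: "complex poly"
  assumes d: "degree P \<ge> 1" and A: "finite A"
  shows "card A * degree P \<le> (\<Sum>v\<in>A. card {z. poly P z = v}) + (degree P - 1)"
proof -
  have W: "wronskian P 1 = pderiv P" by (simp add: wronskian_def)
  have W0: "wronskian P 1 \<noteq> 0" using d by (simp add: W pderiv_eq_0_iff)
  have deg: "degree (fibre_poly P 1 (Some u)) = degree P" for u
    using d by (simp add: degree_diff_eq_left)
  have nz: "fibre_poly P 1 (Some u) \<noteq> 0" for u using deg[of u] d by (metis degree_0 not_one_le_zero)
  have eq: "{x. poly (fibre_poly P 1 (Some u)) x = 0} = {z. poly P z = u}" for u
    by auto
  have "card A * degree P = (\<Sum>v\<in>A. degree P)" by simp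
  also have "\<dots> = (\<Sum>v\<in>A. card {z. poly P z = v} + (\<Sum>x | poly P x = v. order x (wronskian P 1)))"
    by (rule sum.cong[OF refl], subst deg[symmetric], subst degree_fibre_poly_eq_sum[OF _ nz])
      (simp_all only: eq coprime_1_right)
  also have "\<dots> = (\<Sum>v\<in>A. card {z. poly P z = v}) + (\<Sum>v\<in>A. \<Sum>x | poly P x = v. order x (wronskian P 1))"
    by (simp add: sum.distrib)
  also have "(\<Sum>v\<in>A. \<Sum>x | poly P x = v. order x (wronskian P 1)) \<le> degree P - 1"
  proof -
    have "fibre_poly P 1 v \<noteq> 0" if "v \<in> Some ` A" for v using that nz by blast
    from sum_order_fibres_le[OF _ this W0] A
    have "(\<Sum>v\<in>Some ` A. \<Sum>x | poly (fibre_poly P 1 v) x = 0. order x (wronskian P 1)) \<le> degree (wronskian P 1)"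
      by simp
    then show ?thesis unfolding W by (simp add: sum.reindex degree_pderiv)
  qed
  finally show ?thesis by simp
qed

lemma card_poly_fibre_generic:
  fixes P :: "complex poly"
  assumes d: "degree P \<ge> 1" and v: "\<And>z. poly (pderiv P) z = 0 \<Longrightarrow> poly P z \<noteq> v"
  shows "card {z. poly P z = v} = degree P"
proof -
  have W: "wronskian P 1 = pderiv P" by (simp add: wronskian_def)
  have W0: "pderiv P \<noteq> 0" using d by (simp add: W pderiv_eq_0_iff)
  have deg: "degree (fibre_poly P 1 (Some v)) = degree P"
    using d by (simp add: degree_diff_eq_left)
  have nz: "fibre_poly P 1 (Some v) \<noteq> 0" using deg d by (metis degree_0 not_one_le_zero)
  have "(\<Sum>x | poly P x = v. order x (pderiv P)) = 0"
    using v order_0I by (intro sum.neutral) blast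
  then show ?thesis
    using degree_fibre_poly_eq_sum[OF _ nz] unfolding deg by (simp add: W)
qed

section \<open>Critical points in charts and the behaviour at infinity\<close>

lemma critical_point_finite:
  assumes cop: "coprime p q" and W: "poly (wronskian p q) x = 0"
  shows "critical_point (rat_eval p q) (Some x)"
proof (cases "poly q x = 0")
  case False
  let ?u = "poly p x / poly q x"
  \<comment> \<open>Away from the poles the map reads \<open>p / q\<close> minus a constant in the
    charts.\<close>
  have "((\<lambda>w. poly p (x + w) / poly q (x + w) - ?u) has_field_derivative
      poly (wronskian p q) x / (poly q x)^2) (at 0)"
    using False by (auto intro!: derivative_eq_intros simp: wronskian_def power2_eq_square)
  moreover have "\<forall>\<^sub>F w in nhds 0. poly q (x + w) \<noteq> 0"
  proof -
    have "isCont (\<lambda>w. poly q (x + w)) 0" by (intro continuous_intros)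
    then show ?thesis using False
      by (metis add.right_neutral isCont_def tendsto_at_iff_tendsto_nhds tendsto_imp_eventually_ne)
  qed
  then have "\<forall>\<^sub>F w in nhds 0. chart_out (rat_eval p q (Some x)) (rat_eval p q (chart_in (Some x) w))
      = poly p (x + w) / poly q (x + w) - ?u"
    by eventually_elim (use False in simp)
  ultimately have "((\<lambda>w. chart_out (rat_eval p q (Some x)) (rat_eval p q (chart_in (Some x) w))) has_field_derivative
      poly (wronskian p q) x / (poly q x)^2) (at 0)"
    by (subst DERIV_cong_ev[OF refl _ refl]) auto
  then show ?thesis using W by (simp add: critical_point_def DERIV_imp_deriv)
next
  case True
  then have p0: "poly p x \<noteq> 0" using coprime_poly_0[OF cop] by blast
  \<comment> \<open>At a pole the target chart is \<open>1 / v\<close>, so the map reads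
    \<open>q / p\<close>.\<close>
  have "((\<lambda>w. poly q (x + w) / poly p (x + w)) has_field_derivative
      - poly (wronskian p q) x / (poly p x)^2) (at 0)"
    using p0 by (auto intro!: derivative_eq_intros simp: wronskian_def power2_eq_square algebra_simps)
  moreover have "\<forall>\<^sub>F w in nhds 0. poly p (x + w) \<noteq> 0"
  proof -
    have "isCont (\<lambda>w. poly p (x + w)) 0" by (intro continuous_intros)
    then show ?thesis using p0
      by (metis add.right_neutral isCont_def tendsto_at_iff_tendsto_nhds tendsto_imp_eventually_ne)
  qed
  then have "\<forall>\<^sub>F w in nhds 0. chart_out (rat_eval p q (Some x)) (rat_eval p q (chart_in (Some x) w))
      = poly q (x + w) / poly p (x + w)"
    by eventually_elim (use True in simp)
  ultimately have "((\<lambda>w. chart_out (rat_eval p q (Some x)) (rat_eval p q (chart_in (Some x) w))) has_field_derivative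
      - poly (wronskian p q) x / (poly p x)^2) (at 0)"
    by (subst DERIV_cong_ev[OF refl _ refl]) auto
  then show ?thesis using W by (simp add: critical_point_def DERIV_imp_deriv)
qed

text \<open>With \<open>z = 1 / w\<close> the difference quotient \<open>g w / w\<close> becomes
  \<open>z * poly r z / poly s z\<close>, which tends to 0 by the gap of two in the degrees.\<close>

lemma deriv_poly_quotient_at_infinity_eq_0:
  fixes g :: "complex \<Rightarrow> complex"
  assumes deg: "degree r + 2 \<le> degree s" and g0: "g 0 = 0"
    and g: "\<forall>\<^sub>F z in at_infinity. g (1 / z) = poly r z / poly s z"
  shows "deriv g 0 = 0"
proof -
  have "((\<lambda>z. poly (pCons 0 r) z / poly s z) \<longlongrightarrow> 0) at_infinity"
    by (rule poly_divide_tendsto_0_at_infinity) (use deg in \<open>auto simp: degree_pCons_eq_if\<close>)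
  moreover have "\<forall>\<^sub>F z in at_infinity. poly (pCons 0 r) z / poly s z = g (inverse z) / inverse z"
    using g eventually_not_equal_at_infinity[of 0]
    by eventually_elim (simp add: field_simps)
  ultimately have "((\<lambda>z. g (inverse z) / inverse z) \<longlongrightarrow> 0) at_infinity"
    by (rule Lim_transform_eventually)
  then have "((\<lambda>w. g w / w) \<longlongrightarrow> 0) (at 0)"
    using lim_at_infinity_0[of "\<lambda>z. g (inverse z) / inverse z" 0] by (simp add: o_def)
  then have "(g has_field_derivative 0) (at 0)"
    using g0 by (simp add: has_field_derivative_iff)
  then show ?thesis by (rule DERIV_imp_deriv)
qed

lemma eventually_poly_neq_0_at_infinity:
  fixes q :: "complex poly"
  assumes "q \<noteq> 0"
  shows "\<forall>\<^sub>F z in at_infinity. poly q z \<noteq> 0"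
proof -
  have "bounded {z. poly q z = 0}" using poly_roots_finite[OF assms] by (rule finite_imp_bounded)
  then obtain B where "\<And>z. poly q z = 0 \<Longrightarrow> norm z \<le> B" by (auto simp: bounded_iff)
  then show ?thesis unfolding eventually_at_infinity by (intro exI[of _ "B + 1"]) force
qed


text \<open>The coefficient of index \<open>degree r + degree s - 1\<close> is the product of the
  leading coefficients times \<open>degree r - degree s\<close>, which is nonzero in characteristic
  0.\<close>

lemma degree_wronskian_ge:
  assumes "r \<noteq> 0" "degree r < degree s"
  shows "wronskian r s \<noteq> 0 \<and> degree r + degree s - 1 \<le> degree (wronskian r s)"
proof -
  let ?m = "degree r" and ?n = "degree s"
  have s: "coeff (r * pderiv s) (?m + ?n - 1) = lead_coeff r * (of_nat ?n * lead_coeff s)"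
    using coeff_mult_degree_sum[of r "pderiv s"] assms(2)
    by (simp add: degree_pderiv coeff_pderiv)
  have r: "coeff (pderiv r * s) (?m + ?n - 1) = of_nat ?m * lead_coeff r * lead_coeff s"
  \<comment> \<open>For \<open>?m = 0\<close> the truncated subtraction in the degree of
    \<open>pderiv r\<close> would give the wrong index, but then \<open>pderiv r\<close>
    vanishes.\<close>
  proof (cases "?m = 0")
    case True
    then have "pderiv r = 0" by (simp add: pderiv_eq_0_iff)
    then show ?thesis using True by simp
  next
    case False
    then show ?thesis using coeff_mult_degree_sum[of "pderiv r" s]
      by (simp add: degree_pderiv coeff_pderiv)
  qed
  have "coeff (wronskian r s) (?m + ?n - 1) = (of_nat ?m - of_nat ?n) * (lead_coeff r * lead_coeff s)"
    unfolding wronskian_def coeff_diff s r by (simp add: algebra_simps)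
  also have "\<dots> \<noteq> 0" using assms by auto
  finally show ?thesis by (auto intro: le_degree)
qed

text \<open>The coefficient of index \<open>d\<close> vanishes for exactly one value, that at
  infinity. The drop in degree is the multiplicity of infinity in its own fibre.\<close>

lemma degree_fibre_poly:
  assumes q0: "q \<noteq> 0" and d: "max (degree p) (degree q) = d" "d \<ge> 1"
  shows "v \<noteq> rat_eval p q None \<Longrightarrow> degree (fibre_poly p q v) = d"
    and "degree (fibre_poly p q (rat_eval p q None)) < d"
proof -
  have c: "coeff (p - smult u q) d = coeff p (degree q) - u * lead_coeff q"
    and le: "degree (p - smult u q) \<le> d" if "\<not> degree p > degree q" for u
    using that d by (auto simp: max_def degree_diff_le split: if_splits)
  show "degree (fibre_poly p q v) = d" if vi: "v \<noteq> rat_eval p q None"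
  proof (cases "degree p > degree q")
    case True
    then obtain u where "v = Some u" using vi by (cases v) auto
    moreover have "degree (p - smult u q) = degree p"
      by (rule degree_diff_eq_left) (use True degree_smult_le[of u q] in linarith)
    ultimately show ?thesis using True d by simp
  next
    case False
    show ?thesis
    proof (cases v)
      case None
      then show ?thesis using False d by simp
    next
      case (Some u)
      then have "coeff (p - smult u q) d \<noteq> 0"
        using vi False q0 c[OF False, of u] by (auto simp: field_simps)
      then show ?thesis using Some le[OF False, of u] le_degree by (metis antisym fibre_poly_simps(1))
    qed
  qed
  show "degree (fibre_poly p q (rat_eval p q None)) < d"
  proof (cases "degree p > degree q")
    case True
    then show ?thesis using d by simp
  next
    case False
    let ?r = "fibre_poly p q (rat_eval p q None)"
    have "coeff ?r d = 0" "degree ?r \<le> d"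
      using False q0 le[OF False] c[OF False, of "coeff p (degree q) / lead_coeff q"]
      by (auto simp del: coeff_diff)
    then show ?thesis using d(2)
      by (metis le_neq_implies_less leading_coeff_0_iff degree_0 not_one_le_zero)
  qed
qed

text \<open>Otherwise \<open>p\<close> and \<open>q\<close> would be proportional, hence both
  constant by coprimality.\<close>

lemma fibre_poly_neq_0:
  assumes "coprime p q" "max (degree p) (degree q) = d" "d \<ge> 1"
  shows "fibre_poly p q v \<noteq> 0"
proof
  assume z: "fibre_poly p q v = 0"
  have q0: "is_unit q" if "p = smult u q" for u using that assms(1)
    by (metis coprime_common_divisor dvd_refl dvd_smult)
  show False
  proof (cases v)
    case None
    then have "q = 0" "is_unit p" using z assms(1) by auto
    then show False using assms by (auto simp: is_unit_poly_iff)
  next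
    case (Some u)
    then have "p = smult u q" using z by simp
    with q0[OF this] have "degree q = 0" "degree p = 0"
      by (auto simp: is_unit_poly_iff)
    then show False using assms by simp
  qed
qed

text \<open>The local degree at infinity is the degree drop. In the charts the map is a quotient of
  polynomials whose degrees differ by this drop.\<close>

lemma critical_point_infinity:
  assumes q0: "q \<noteq> 0" and d: "max (degree p) (degree q) = d" "d \<ge> 1"
    and deg: "degree (fibre_poly p q (rat_eval p q None)) + 2 \<le> d"
  shows "critical_point (rat_eval p q) None"
proof (cases "degree p > degree q")
  case True
  then have "p \<noteq> 0" by auto
  have "deriv (\<lambda>w. chart_out (rat_eval p q None) (rat_eval p q (chart_in None w))) 0 = 0"
  proof (rule deriv_poly_quotient_at_infinity_eq_0[of q p])
    show "degree q + 2 \<le> degree p" using deg True d by simp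
    show "\<forall>\<^sub>F z in at_infinity. chart_out (rat_eval p q None) (rat_eval p q (chart_in None (1 / z))) = poly q z / poly p z"
      using eventually_poly_neq_0_at_infinity[OF q0] eventually_not_equal_at_infinity[of 0]
      by eventually_elim (use True in simp)
  qed (use True in simp)
  then show ?thesis by (simp add: critical_point_def)
next
  case False
  let ?u = "coeff p (degree q) / lead_coeff q"
  have "deriv (\<lambda>w. chart_out (rat_eval p q None) (rat_eval p q (chart_in None w))) 0 = 0"
  proof (rule deriv_poly_quotient_at_infinity_eq_0[of "p - smult ?u q" q])
    show "degree (p - smult ?u q) + 2 \<le> degree q" using deg False d by simp
    show "\<forall>\<^sub>F z in at_infinity. chart_out (rat_eval p q None) (rat_eval p q (chart_in None (1 / z))) = poly (p - smult ?u q) z / poly q z"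
      using eventually_poly_neq_0_at_infinity[OF q0] eventually_not_equal_at_infinity[of 0]
      by eventually_elim (use False in \<open>simp add: diff_divide_distrib\<close>)
  qed (use False in simp)
  then show ?thesis by (simp add: critical_point_def)
qed

section \<open>The Riemann-Hurwitz inequality\<close>

lemma card_rat_eval_fibre:
  assumes q0: "q \<noteq> 0" and cop: "coprime p q" and d: "max (degree p) (degree q) = d" "d \<ge> 1"
  shows "card (rat_eval p q -` {v}) = card {x. poly (fibre_poly p q v) x = 0}
           + (if v = rat_eval p q None then 1 else 0)"
proof -
  let ?F = "{x. poly (fibre_poly p q v) x = 0}"
  have fin: "finite ?F" by (rule poly_roots_finite[OF fibre_poly_neq_0[OF cop d]])
  have eq: "rat_eval p q -` {v} = Some ` ?F \<union> (if v = rat_eval p q None then {None} else {})"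
    (is "?L = ?R")
  proof (rule set_eqI)
    fix y show "y \<in> ?L \<longleftrightarrow> y \<in> ?R"
      using rat_eval_Some_eq_iff[OF cop, of _ v] by (cases y) (auto simp del: rat_eval.simps)
  qed
  have "card (Some ` ?F \<union> (if v = rat_eval p q None then {None} else {}))
      = card (Some ` ?F) + card (if v = rat_eval p q None then {None::complex option} else {})"
    using fin by (intro card_Un_disjoint) auto
  then show "card (rat_eval p q -` {v}) = card ?F + (if v = rat_eval p q None then 1 else 0)"
    unfolding eq by (simp add: card_image del: rat_eval.simps)
qed

text \<open>With \<open>r\<close> the fibre polynomial over the value at infinity, the zeros of the
  Wronskian account for at least \<open>degree r + d - 1\<close> missing preimages and infinity for
  \<open>d - degree r - 1\<close>, together \<open>2 * d - 2\<close>.\<close>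

lemma riemann_hurwitz_le:
  assumes q0: "q \<noteq> 0" and cop: "coprime p q" and d: "max (degree p) (degree q) = d" "d \<ge> 1"
    and V: "finite V" and crit: "\<And>c. critical_point (rat_eval p q) c \<Longrightarrow> rat_eval p q c \<in> V"
  shows "(\<Sum>v\<in>V. card (rat_eval p q -` {v})) + (2 * d - 2) \<le> card V * d"
    and "v \<notin> V \<Longrightarrow> v \<noteq> rat_eval p q None \<Longrightarrow> card (rat_eval p q -` {v}) = d"
proof -
  let ?W = "wronskian p q" and ?i = "rat_eval p q None"
  let ?F = "\<lambda>v. {x. poly (fibre_poly p q v) x = 0}"
  let ?o = "\<lambda>v. \<Sum>x\<in>?F v. order x ?W"
  define r where "r = fibre_poly p q ?i"
  \<comment> \<open>The ramification at infinity, charged to the fibre that contains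
    infinity.\<close>
  define e where "e v = (if v = ?i then d - degree r - 1 else 0)" for v
  note nz = fibre_poly_neq_0[OF cop d]
  note deg = degree_fibre_poly[OF q0 d]
  \<comment> \<open>In both cases the Wronskian is, up to sign, that of \<open>r\<close> and a
    polynomial of degree \<open>d\<close>.\<close>
  have "?W \<noteq> 0 \<and> degree r + d - 1 \<le> degree ?W"
  proof (cases "degree p > degree q")
    case True
    then have "r = q" "d = degree p" using d by (auto simp: r_def)
    then show ?thesis using degree_wronskian_ge[of q p] True q0 wronskian_commute[of q p] by simp
  next
    case False
    then have "r = p - smult (coeff p (degree q) / lead_coeff q) q" and dq: "d = degree q"
      using d by (auto simp: r_def)
    then have "wronskian r q = ?W" by (metis wronskian_diff_smult)
    then show ?thesis using degree_wronskian_ge[of r q] nz[of ?i] deg(2)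
      unfolding r_def[symmetric] dq by simp
  qed
  then have W: "?W \<noteq> 0" "degree r + d - 1 \<le> degree ?W" by auto
  have critW: "rat_eval p q (Some x) \<in> V" if "poly ?W x = 0" for x
    using crit critical_point_finite[OF cop that] by blast
  have count: "d = card (rat_eval p q -` {v}) + ?o v + e v" for v
  proof (cases "v = ?i")
    case True
    have "degree r = card (?F v) + ?o v"
      using degree_fibre_poly_eq_sum[OF cop nz, of v] unfolding True r_def .
    then show ?thesis using deg(2) card_rat_eval_fibre[OF q0 cop d, of v]
      unfolding e_def r_def[symmetric] by (simp add: True)
  next
    case False
    then show ?thesis
      using degree_fibre_poly_eq_sum[OF cop nz, of v] deg(1)[OF False] card_rat_eval_fibre[OF q0 cop d, of v]
      unfolding e_def by simp
  qed
  have e: "d - degree r - 1 \<le> (\<Sum>v\<in>V. e v)"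
  proof (cases "?i \<in> V")
    case True
    then show ?thesis using member_le_sum[OF True _ V, of e] by (simp add: e_def del: rat_eval.simps)
  next
    case False
    \<comment> \<open>If the value at infinity is outside \<open>V\<close>, then infinity is not
      critical and contributes 0.\<close>
    then have "\<not> degree r + 2 \<le> d"
      using crit critical_point_infinity[OF q0 d] unfolding r_def by blast
    then show ?thesis by simp
  qed
  have "degree ?W \<le> (\<Sum>v\<in>V. ?o v)"
    by (rule sum_order_fibres_ge[OF cop nz W(1) V critW])
  moreover have "card V * d = (\<Sum>v\<in>V. card (rat_eval p q -` {v}) + ?o v + e v)"
    using sum.cong[OF refl count, of V] by simp
  ultimately show "(\<Sum>v\<in>V. card (rat_eval p q -` {v})) + (2 * d - 2) \<le> card V * d"
    using W(2) e deg(2) unfolding r_def[symmetric] by (simp add: sum.distrib)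
  show "card (rat_eval p q -` {v}) = d" if "v \<notin> V" "v \<noteq> ?i"
  proof -
    have "order x ?W = 0" if "x \<in> ?F v" for x
      using that \<open>v \<notin> V\<close> critW[of x] rat_eval_Some_eq_iff[OF cop, of x v] by (auto intro: order_0I)
    then have "?o v = 0" by simp
    then show ?thesis using count[of v] that by (simp add: e_def)
  qed
qed

section \<open>The Boettcher coordinate\<close>

text \<open>The two orbits differ at most by the point \<open>z\<close>.\<close>

lemma poly_in_filled_julia_iff: "poly P z \<in> filled_julia P \<longleftrightarrow> z \<in> filled_julia P"
proof -
  have "range (\<lambda>n. (poly P ^^ n) z) = insert z (range (\<lambda>n. (poly P ^^ n) (poly P z)))"
  proof (intro set_eqI iffI)
    fix y assume "y \<in> range (\<lambda>n. (poly P ^^ n) z)"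
    then obtain n where "y = (poly P ^^ n) z" by blast
    then show "y \<in> insert z (range (\<lambda>n. (poly P ^^ n) (poly P z)))"
      by (cases n) (auto simp: funpow_Suc_right simp del: funpow.simps)
  next
    fix y assume "y \<in> insert z (range (\<lambda>n. (poly P ^^ n) (poly P z)))"
    then consider "y = (poly P ^^ 0) z" | n where "y = (poly P ^^ Suc n) z"
      by (auto simp: funpow_Suc_right simp del: funpow.simps(2))
    then show "y \<in> range (\<lambda>n. (poly P ^^ n) z)" by cases blast+
  qed
  then show ?thesis by (simp add: filled_julia_def)
qed

text \<open>The bound is given only near the circle, so the maximum principle is applied on
  \<open>cball 0 s\<close> with \<open>s < 1\<close> large enough for the bound
  \<open>1 + e\<close>.\<close>

lemma norm_le_1_on_disc:
  fixes h :: "complex \<Rightarrow> complex"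
  assumes hol: "h holomorphic_on ball 0 1"
    and bdry: "\<And>e. e > 0 \<Longrightarrow> \<exists>r<1. \<forall>z. r < cmod z \<and> cmod z < 1 \<longrightarrow> cmod (h z) \<le> 1 + e"
    and z: "cmod z < 1"
  shows "cmod (h z) \<le> 1"
proof (rule field_le_epsilon)
  fix e :: real assume "e > 0"
  then obtain r where r: "r < 1" "\<And>z. r < cmod z \<Longrightarrow> cmod z < 1 \<Longrightarrow> cmod (h z) \<le> 1 + e"
    using bdry by metis
  obtain s where s: "max (max r (cmod z)) 0 < s" "s < 1"
    using dense[of "max (max r (cmod z)) 0" 1] r(1) z by auto
  have sub: "cball 0 s \<subseteq> ball (0::complex) 1" using s by auto
  show "cmod (h z) \<le> 1 + e"
  proof (rule maximum_modulus_frontier[of h "cball 0 s"])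
    show "h holomorphic_on interior (cball 0 s)"
      using hol sub by (meson holomorphic_on_subset interior_subset order_trans)
    show "continuous_on (closure (cball 0 s)) h"
      using holomorphic_on_imp_continuous_on[OF hol] sub by (simp add: continuous_on_subset)
    show "cmod (h w) \<le> 1 + e" if "w \<in> frontier (cball 0 s)" for w
      using that s by (intro r(2)) auto
    show "z \<in> cball 0 s" using s by simp
  qed auto
qed

locale boettcher =
  fixes P :: "complex poly" and \<Phi> :: "complex \<Rightarrow> complex"
  assumes ext: "riemann_map_ext P \<Phi>" and monic: "lead_coeff P = 1" and degree_ge_2: "degree P \<ge> 2"
begin

abbreviation "U \<equiv> {z::complex. 1 < cmod z}"
abbreviation "E \<equiv> {z::complex. 1 \<le> cmod z}"
abbreviation "K \<equiv> filled_julia P"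
abbreviation "S \<equiv> \<Phi> ` sphere 0 1"

lemma hol: "\<Phi> holomorphic_on U" and inj: "inj_on \<Phi> U" and image_U: "\<Phi> ` U = - K"
  and cont: "continuous_on E \<Phi>"
  using ext by (auto simp: riemann_map_ext_def)

lemma open_U: "open U"
  by (intro open_Collect_less continuous_intros)

lemma closure_U: "closure U = E"
proof -
  have "closure (- cball (0::complex) 1) = - ball 0 1" by (simp add: closure_complement)
  moreover have "- cball (0::complex) 1 = U" "- ball (0::complex) 1 = E" by auto
  ultimately show ?thesis by simp
qed

section \<open>The boundary of the filled Julia set\<close>

lemma filterlim_\<Phi>: "filterlim \<Phi> at_infinity at_infinity"
proof -
  obtain c :: real where c: "c > 0" "((\<lambda>z. \<Phi> z / z) \<longlongrightarrow> complex_of_real c) at_infinity"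
    using ext by (auto simp: riemann_map_ext_def)
  have "filterlim (\<lambda>z. \<Phi> z / z * z) at_infinity at_infinity"
    by (rule tendsto_mult_filterlim_at_infinity[OF c(2)]) (use c(1) in \<open>auto simp: filterlim_ident\<close>)
  moreover have "\<forall>\<^sub>F z in at_infinity. \<Phi> z / z * z = \<Phi> z"
    using eventually_not_equal_at_infinity[of 0] by eventually_elim simp
  ultimately show ?thesis by (simp add: filterlim_cong)
qed

text \<open>\<open>\<Phi>\<close> is proper: it tends to infinity, so the parameters of a convergent
  sequence of values stay bounded and accumulate inside \<open>T\<close>.\<close>

lemma closed_image:
  assumes "closed T" "T \<subseteq> E"
  shows "closed (\<Phi> ` T)"
  unfolding closed_sequential_limits
proof (intro allI impI, elim conjE)
  fix x l assume x: "\<forall>n. x n \<in> \<Phi> ` T" and l: "x \<longlonglongrightarrow> l"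
  then have "\<forall>n. \<exists>w. w \<in> T \<and> x n = \<Phi> w" by blast
  then obtain w where w: "\<And>n. w n \<in> T" "\<And>n. x n = \<Phi> (w n)" by metis
  obtain M where M: "\<And>n. cmod (x n) \<le> M"
    using convergent_imp_bounded[OF l] by (auto simp: bounded_iff)
  have "\<forall>\<^sub>F z in at_infinity. \<bar>M\<bar> + 1 \<le> cmod (\<Phi> z)"
    using filterlim_\<Phi> unfolding filterlim_at_infinity[OF abs_ge_zero[of M]] by auto
  then obtain b where "\<And>z. b \<le> cmod z \<Longrightarrow> \<bar>M\<bar> + 1 \<le> cmod (\<Phi> z)"
    by (auto simp: eventually_at_infinity)
  then have "cmod (w n) \<le> b" for n using M[of n] w(2)[of n] by (smt (verit))
  then have "bounded (range w)" by (auto simp: bounded_iff)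
  then obtain y r where y: "strict_mono r" "(w \<circ> r) \<longlonglongrightarrow> y"
    using bounded_imp_convergent_subsequence by blast
  have "y \<in> T" using closed_sequentially[OF assms(1) _ y(2)] w(1) by simp
  have "(\<lambda>n. \<Phi> ((w \<circ> r) n)) \<longlonglongrightarrow> \<Phi> y"
    by (rule continuous_on_tendsto_compose[OF cont y(2)]) (use w(1) \<open>y \<in> T\<close> assms(2) in \<open>auto intro!: always_eventually\<close>)
  moreover have "(\<lambda>n. \<Phi> ((w \<circ> r) n)) = x \<circ> r" using w(2) by auto
  ultimately have "l = \<Phi> y"
    using LIMSEQ_subseq_LIMSEQ[OF l y(1)] LIMSEQ_unique by metis
  then show "l \<in> \<Phi> ` T" using \<open>y \<in> T\<close> by blast
qed

text \<open>If a boundary value were also a value at some \<open>z0\<close> in \<open>U\<close>, the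
  open image of a region around \<open>z0\<close> away from the circle would contain values taken
  near the circle, against injectivity.\<close>

lemma S_subset_K: "S \<subseteq> K"
proof (rule ccontr)
  assume "\<not> S \<subseteq> K"
  then obtain \<zeta> where \<zeta>: "cmod \<zeta> = 1" "\<Phi> \<zeta> \<in> - K" by force
  then obtain z0 where z0: "cmod z0 > 1" "\<Phi> \<zeta> = \<Phi> z0" unfolding image_U[symmetric] by blast
  define m where "m = (1 + cmod z0) / 2"
  have m: "1 < m" "m < cmod z0" using z0 by (auto simp: m_def)
  let ?N = "U \<inter> - cball 0 m"
  have "open (\<Phi> ` ?N)"
  proof (rule open_mapping_thm3)
    show "\<Phi> holomorphic_on ?N" using hol by (rule holomorphic_on_subset) auto
    show "inj_on \<Phi> ?N" using inj by (rule inj_on_subset) auto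
  qed (use open_U in auto)
  then have cl: "closed (- \<Phi> ` ?N)" by (simp add: closed_def)
  have clo: "closure (ball 0 m \<inter> U) \<subseteq> E"
    unfolding closure_U[symmetric] by (intro closure_mono) auto
  have "\<Phi> ` closure (ball 0 m \<inter> U) \<subseteq> - \<Phi> ` ?N"
  proof (rule image_closure_subset[OF _ cl])
    show "continuous_on (closure (ball 0 m \<inter> U)) \<Phi>"
      using cont clo by (rule continuous_on_subset)
    show "\<Phi> ` (ball 0 m \<inter> U) \<subseteq> - \<Phi> ` ?N"
      using inj by (auto dest!: inj_onD)
  qed
  moreover have "\<zeta> \<in> closure (ball 0 m \<inter> U)"
    using open_Int_closure_subset[of "ball 0 m" U] closure_U \<zeta>(1) m(1) by auto
  ultimately have "\<Phi> \<zeta> \<notin> \<Phi> ` ?N" by blast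
  moreover have "z0 \<in> ?N" using z0 m by auto
  ultimately show False using z0(2) by auto
qed

text \<open>\<open>S\<close> is the boundary of \<open>K\<close>. One inclusion is continuity up to
  the circle; for the other, the image of \<open>E\<close> is closed and contains the complement of
  \<open>K\<close>.\<close>

lemma S_eq: "S = K \<inter> closure (- K)"
proof
  have "\<Phi> ` closure U \<subseteq> closure (- K)"
    using image_closure_subset[of U \<Phi> "closure (- K)"] cont image_U closure_subset[of "- K"]
    unfolding closure_U by auto
  then show "S \<subseteq> K \<inter> closure (- K)" using S_subset_K unfolding closure_U by auto
  have "closed E" using closure_U closed_closure[of U] by simp
  then have "closure (- K) \<subseteq> \<Phi> ` E"
    using closed_image[of E] unfolding image_U[symmetric] by (intro closure_minimal) auto
  moreover have "\<Phi> z \<notin> K" if "cmod z > 1" for z using that image_U by blast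
  ultimately show "K \<inter> closure (- K) \<subseteq> S" by force
qed

lemma open_K_minus_S: "open (K - S)"
proof -
  have "K - S = - closure (- K)" unfolding S_eq using closure_subset[of "- K"] by auto
  then show ?thesis by (simp only: open_Compl closed_closure)
qed

section \<open>The functional equation of the Riemann map\<close>

lemma boettcher_map:
  obtains B where "B holomorphic_on U" "\<And>z. z \<in> U \<Longrightarrow> B z \<in> U" "\<And>z. z \<in> U \<Longrightarrow> \<Phi> (B z) = poly P (\<Phi> z)"
proof -
  \<comment> \<open>\<open>P\<close> preserves the complement of \<open>K\<close>, so it lifts
    through the inverse \<open>g\<close> of \<open>\<Phi>\<close>.\<close>
  obtain g where g: "g holomorphic_on (\<Phi> ` U)" "\<And>z. z \<in> U \<Longrightarrow> g (\<Phi> z) = z"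
    using holomorphic_has_inverse[OF hol open_U inj] by metis
  have PK: "poly P (\<Phi> z) \<in> \<Phi> ` U" if "z \<in> U" for z
    using that poly_in_filled_julia_iff[of P "\<Phi> z"] image_U by blast
  show ?thesis
  proof
    have "(g \<circ> (\<lambda>z. poly P (\<Phi> z))) holomorphic_on U"
    proof (rule holomorphic_on_compose_gen[OF _ g(1)])
      show "(\<lambda>z. poly P (\<Phi> z)) holomorphic_on U"
        by (intro holomorphic_intros hol)
    qed (use PK in blast)
    then show "(\<lambda>z. g (poly P (\<Phi> z))) holomorphic_on U" by (simp add: o_def)
  next
    fix z assume "z \<in> U"
    then obtain w where "w \<in> U" "poly P (\<Phi> z) = \<Phi> w" using PK by blast
    then show "g (poly P (\<Phi> z)) \<in> U" "\<Phi> (g (poly P (\<Phi> z))) = poly P (\<Phi> z)"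
      using g(2) by metis+
  qed
qed

text \<open>The points near the circle at which the conclusion fails lie in a compact set that
  misses the circle, since \<open>P\<close> maps \<open>S\<close> into \<open>K\<close>; so their
  moduli are bounded away from 1.\<close>

lemma boettcher_map_boundary:
  assumes B: "\<And>z. z \<in> U \<Longrightarrow> B z \<in> U" "\<And>z. z \<in> U \<Longrightarrow> \<Phi> (B z) = poly P (\<Phi> z)" and e: "e > 0"
  shows "\<exists>\<rho>>1. \<forall>z. 1 < cmod z \<and> cmod z < \<rho> \<longrightarrow> cmod (B z) < 1 + e"
proof -
  let ?T = "- ball (0::complex) (1 + e)"
  let ?A = "cball (0::complex) 2 \<inter> - ball 0 1"
  \<comment> \<open>Described through \<open>\<Phi>\<close>, which is continuous up to the circle,
    because \<open>B\<close> is only given on \<open>U\<close>.\<close>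
  define C where "C = ?A \<inter> (\<lambda>z. poly P (\<Phi> z)) -` (\<Phi> ` ?T)"
  have TE: "?T \<subseteq> E" using e by auto
  have cA: "continuous_on ?A \<Phi>" using cont by (rule continuous_on_subset) auto
  have "closed C" unfolding C_def
  proof (rule continuous_closed_preimage)
    show "continuous_on ?A (\<lambda>z. poly P (\<Phi> z))" by (intro continuous_intros cA)
    show "closed (\<Phi> ` ?T)" using TE by (intro closed_image) (simp_all add: closed_def)
    show "closed ?A" by (simp add: closed_Int closed_def[of "- ball 0 1"])
  qed
  moreover have "bounded C" unfolding C_def by (meson bounded_cball bounded_subset inf_le1 order_trans)
  ultimately have comp: "compact C" by (simp add: compact_eq_bounded_closed)
  have notS: "cmod z > 1" if "z \<in> C" for z
  proof (rule ccontr)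
    assume "\<not> cmod z > 1"
    then have "\<Phi> z \<in> S" using that by (auto simp: C_def)
    then have "poly P (\<Phi> z) \<in> K" using S_subset_K poly_in_filled_julia_iff by blast
    moreover have "poly P (\<Phi> z) \<in> \<Phi> ` U" using that e by (auto simp: C_def)
    ultimately show False using image_U by blast
  qed
  have inC: "z \<in> C" if "1 < cmod z" "cmod z \<le> 2" "\<not> cmod (B z) < 1 + e" for z
    unfolding C_def using that B(2)[of z, symmetric] by (auto intro!: imageI)
  show ?thesis
  proof (cases "C = {}")
    case True
    then show ?thesis using inC by (intro exI[of _ 2]) force
  next
    case False
    then obtain x where x: "x \<in> C" "\<And>y. y \<in> C \<Longrightarrow> cmod x \<le> cmod y"
      using continuous_attains_inf[OF comp False, of cmod] continuous_on_norm_id by metis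
    have "cmod x \<le> 2" using x(1) by (auto simp: C_def)
    then show ?thesis using inC x notS[OF x(1)] by (intro exI[of _ "cmod x"]) force
  qed
qed

text \<open>With \<open>B\<close> the lift of \<open>P\<close> through \<open>\<Phi>\<close>, the quotient \<open>B z / z ^ degree P\<close> has no zeros, tends to
  a positive number at infinity, and its modulus tends to 1 at the unit circle, so by the maximum
  principle for it and for its reciprocal it is identically 1.\<close>

lemma poly_\<Phi>_outside:
  assumes "z \<in> U"
  shows "poly P (\<Phi> z) = \<Phi> (z ^ degree P)"
proof -
  let ?d = "degree P"
  obtain B where B: "B holomorphic_on U" "\<And>z. z \<in> U \<Longrightarrow> B z \<in> U"
      "\<And>z. z \<in> U \<Longrightarrow> \<Phi> (B z) = poly P (\<Phi> z)"
    using boettcher_map by blast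
  obtain c :: real where c: "c > 0" "((\<lambda>z. \<Phi> z / z) \<longlongrightarrow> complex_of_real c) at_infinity"
    using ext by (auto simp: riemann_map_ext_def)
  have evU: "\<forall>\<^sub>F z in at_infinity. z \<in> U"
    unfolding eventually_at_infinity by (intro exI[of _ 2]) auto
  have P\<Phi>: "filterlim (\<lambda>z. poly P (\<Phi> z)) at_infinity at_infinity"
    using filterlim_compose[OF filterlim_poly_at_infinity filterlim_\<Phi>] degree_ge_2 by simp
  \<comment> \<open>Bounded values of \<open>B\<close> would give bounded values of
    \<open>\<Phi> (B z) = poly P (\<Phi> z)\<close> by compactness.\<close>
  have limB: "filterlim B at_infinity at_infinity"
    unfolding filterlim_at_infinity[OF order_refl]
  proof (intro allI impI)
    fix r :: real
    have "compact (cball 0 r \<inter> - ball (0::complex) 1)"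
      by (intro compact_Int_closed) (auto simp: closed_def)
    then have "compact (\<Phi> ` (cball 0 r \<inter> - ball 0 1))"
      by (intro compact_continuous_image continuous_on_subset[OF cont]) auto
    then obtain M where M: "\<And>z. z \<in> cball 0 r \<inter> - ball 0 1 \<Longrightarrow> cmod (\<Phi> z) \<le> M"
      using compact_imp_bounded by (fastforce simp: bounded_iff)
    have "\<forall>\<^sub>F z in at_infinity. \<bar>M\<bar> + 1 \<le> cmod (poly P (\<Phi> z))"
      using P\<Phi> unfolding filterlim_at_infinity[OF abs_ge_zero[of M]] by simp
    with evU show "\<forall>\<^sub>F z in at_infinity. r \<le> cmod (B z)"
    proof eventually_elim
      case (elim z)
      show ?case
      proof (rule ccontr)
        assume "\<not> r \<le> cmod (B z)"
        then have "cmod (\<Phi> (B z)) \<le> M" using B(2)[OF elim(1)] by (intro M) auto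
        then show False using elim B(3) by auto
      qed
    qed
  qed
  define G where "G z = B z / z ^ ?d" for z
  \<comment> \<open>As \<open>\<Phi> (B z) = poly P (\<Phi> z)\<close>, the product cancels to
    \<open>G z\<close>. The first factor tends to 1 because \<open>P\<close> is monic.\<close>
  have "((\<lambda>z. (poly P (\<Phi> z) / \<Phi> z ^ ?d) * (\<Phi> z / z) ^ ?d / (\<Phi> (B z) / B z)) \<longlongrightarrow>
      1 * complex_of_real c ^ ?d / complex_of_real c) at_infinity"
  proof (intro tendsto_intros c(2))
    show "((\<lambda>z. poly P (\<Phi> z) / \<Phi> z ^ ?d) \<longlongrightarrow> 1) at_infinity"
      using filterlim_compose[OF poly_divide_tendsto_aux filterlim_\<Phi>] monic by metis
    show "((\<lambda>z. \<Phi> (B z) / B z) \<longlongrightarrow> complex_of_real c) at_infinity"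
      by (rule filterlim_compose[OF c(2) limB])
  qed (use c(1) in auto)
  moreover have "\<forall>\<^sub>F z in at_infinity.
      (poly P (\<Phi> z) / \<Phi> z ^ ?d) * (\<Phi> z / z) ^ ?d / (\<Phi> (B z) / B z) = G z"
    using evU filterlim_at_infinity_imp_eventually_ne[OF P\<Phi>, of 0]
      filterlim_at_infinity_imp_eventually_ne[OF filterlim_\<Phi>, of 0]
    by eventually_elim (auto simp: G_def B(3) power_divide)
  ultimately have "(G \<longlongrightarrow> 1 * complex_of_real c ^ ?d / complex_of_real c) at_infinity"
    by (rule Lim_transform_eventually)
  also have "1 * complex_of_real c ^ ?d / complex_of_real c = of_real (c ^ (?d - 1))"
    using c(1) degree_ge_2 by (simp add: power_diff)
  finally have G: "((G \<circ> inverse) \<longlongrightarrow> of_real (c ^ (?d - 1))) (at 0)"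
    unfolding lim_at_infinity_0 .
  \<comment> \<open>\<open>G\<close> in the coordinate \<open>1 / z\<close>, with the removable
    singularity at 0 filled in.\<close>
  define h where "h \<zeta> = (if \<zeta> = 0 then of_real (c ^ (?d - 1)) else (G \<circ> inverse) \<zeta>)" for \<zeta>
  have invU: "inverse \<zeta> \<in> U" if "\<zeta> \<in> ball 0 1 - {0}" for \<zeta>
    using that by (simp add: norm_inverse one_less_inverse)
  have "G holomorphic_on U"
    unfolding G_def by (intro holomorphic_intros B(1)) auto
  then have "(G \<circ> inverse) holomorphic_on ball 0 1 - {0}"
    by (intro holomorphic_on_compose_gen[of inverse _ G U] holomorphic_intros) (use invU in auto)
  from removable_singularity[OF this open_ball G]
  have holh: "h holomorphic_on ball 0 1" unfolding h_def .
  have hB: "h \<zeta> = B (inverse \<zeta>) * \<zeta> ^ ?d" if "\<zeta> \<noteq> 0" for \<zeta>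
    using that by (simp add: h_def G_def power_inverse divide_inverse)
  have hnz: "h \<zeta> \<noteq> 0" if "\<zeta> \<in> ball 0 1" for \<zeta>
  proof (cases "\<zeta> = 0")
    case True
    then show ?thesis using c(1) by (simp add: h_def)
  next
    case False
    then have "B (inverse \<zeta>) \<in> U" using that by (intro B(2) invU) auto
    then show ?thesis using hB[OF False] False by auto
  qed
  have le1: "cmod (h \<zeta>) \<le> 1" if "cmod \<zeta> < 1" for \<zeta>
  proof (rule norm_le_1_on_disc[OF holh _ that])
    fix e :: real assume "e > 0"
    then obtain \<rho> where \<rho>: "\<rho> > 1" "\<And>z. 1 < cmod z \<Longrightarrow> cmod z < \<rho> \<Longrightarrow> cmod (B z) < 1 + e"
      using boettcher_map_boundary[OF B(2,3)] by metis
    have "cmod (h z) \<le> 1 + e" if z: "inverse \<rho> < cmod z" "cmod z < 1" for z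
    proof -
      have z0: "z \<noteq> 0" using z \<rho>(1) by auto
      have "cmod (inverse z) < \<rho>"
        unfolding norm_inverse using z(1) \<rho>(1) z0 by (simp add: field_simps)
      moreover have "1 < cmod (inverse z)" using invU[of z] z z0 by simp
      ultimately have "cmod (B (inverse z)) < 1 + e" by (intro \<rho>(2))
      moreover have "cmod z ^ ?d \<le> 1" using z(2) by (simp add: power_le_one)
      ultimately have "cmod (B (inverse z)) * cmod z ^ ?d \<le> (1 + e) * 1"
        by (intro mult_mono) (use \<open>e > 0\<close> in auto)
      then show ?thesis using hB[OF z0] by (simp add: norm_mult norm_power)
    qed
    moreover have "inverse \<rho> < 1" using \<rho>(1) by (simp add: inverse_less_1_iff)
    ultimately show "\<exists>r<1. \<forall>z. r < cmod z \<and> cmod z < 1 \<longrightarrow> cmod (h z) \<le> 1 + e" by blast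
  qed
  have ge1: "cmod (inverse (h \<zeta>)) \<le> 1" if "cmod \<zeta> < 1" for \<zeta>
  proof (rule norm_le_1_on_disc[of "\<lambda>\<zeta>. inverse (h \<zeta>)", OF _ _ that])
    show "(\<lambda>\<zeta>. inverse (h \<zeta>)) holomorphic_on ball 0 1"
      by (intro holomorphic_intros holh) (use hnz in auto)
    fix e :: real assume "e > 0"
    \<comment> \<open>As \<open>B\<close> has modulus above 1, \<open>1 / cmod (h z)\<close> is at
      most \<open>1 / cmod z ^ ?d\<close>, which tends to 1 at the circle.\<close>
    have "isCont (\<lambda>x::real. inverse (x ^ ?d)) 1" by (intro continuous_intros) auto
    then have "((\<lambda>x::real. inverse (x ^ ?d)) \<longlongrightarrow> 1) (at_left 1)"
      unfolding isCont_def by (simp add: filterlim_at_split)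
    then have "\<forall>\<^sub>F x in at_left (1::real). inverse (x ^ ?d) < 1 + e"
      using \<open>e > 0\<close> by (intro order_tendstoD) auto
    then obtain r where r: "r < 1" "\<And>x. r < x \<Longrightarrow> x < 1 \<Longrightarrow> inverse (x ^ ?d) < 1 + e"
      unfolding eventually_at_left_field by blast
    have "cmod (inverse (h z)) \<le> 1 + e" if z: "max r 0 < cmod z" "cmod z < 1" for z
    proof -
      have z0: "z \<noteq> 0" using z by auto
      then have "1 < cmod (B (inverse z))" using B(2)[OF invU[of z]] z by auto
      then have "inverse (cmod (B (inverse z))) \<le> 1" by (simp add: inverse_le_1_iff)
      moreover have "inverse (cmod z ^ ?d) \<le> 1 + e" using r(2)[of "cmod z"] z by simp
      ultimately have "inverse (cmod (B (inverse z))) * inverse (cmod z ^ ?d) \<le> 1 * (1 + e)"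
        by (intro mult_mono) auto
      then show ?thesis using hB[OF z0] by (simp add: norm_mult norm_power norm_inverse)
    qed
    then show "\<exists>r<1. \<forall>z. r < cmod z \<and> cmod z < 1 \<longrightarrow> cmod (inverse (h z)) \<le> 1 + e"
      using r(1) by (intro exI[of _ "max r 0"]) auto
  qed
  have norm1: "cmod (h \<zeta>) = 1" if "cmod \<zeta> < 1" for \<zeta>
    using le1[OF that] ge1[OF that] hnz[of \<zeta>] that
    by (simp add: norm_inverse inverse_le_1_iff)
  have "h constant_on ball 0 1"
    by (rule maximum_modulus_principle[OF holh open_ball connected_ball open_ball order_refl, of 0])
      (use norm1 in auto)
  then have const: "h \<zeta> = h 0" if "\<zeta> \<in> ball 0 1" for \<zeta>
    using that unfolding constant_on_def by (metis centre_in_ball zero_less_one)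
  \<comment> \<open>\<open>h 0\<close> is a positive real number of modulus 1.\<close>
  have "h 0 = 1"
    using norm1[of 0] c(1) by (simp add: h_def norm_power)
  have z0: "z \<noteq> 0" "inverse z \<in> ball 0 1" using assms by (auto simp: norm_inverse inverse_less_1_iff)
  then have "B z * inverse z ^ ?d = 1"
    using hB[of "inverse z"] const[of "inverse z"] \<open>h 0 = 1\<close> by simp
  then have "B z = z ^ ?d" using z0(1) by (simp add: field_simps power_inverse)
  then show ?thesis using B(3)[OF assms] by simp
qed

lemma poly_\<Phi>:
  assumes "z \<in> E"
  shows "poly P (\<Phi> z) = \<Phi> (z ^ degree P)"
proof -
  have "poly P (\<Phi> z) - \<Phi> (z ^ degree P) = 0"
  proof (rule continuous_constant_on_closure[of U "\<lambda>z. poly P (\<Phi> z) - \<Phi> (z ^ degree P)"])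
    show "continuous_on (closure U) (\<lambda>z. poly P (\<Phi> z) - \<Phi> (z ^ degree P))"
      unfolding closure_U
      by (intro continuous_intros cont continuous_on_compose2[OF cont]) (auto simp: norm_power one_le_power)
  qed (use assms closure_U poly_\<Phi>_outside in auto)
  then show ?thesis by simp
qed

text \<open>Points of \<open>S\<close> stay in \<open>S\<close> by \<open>poly_\<Phi>\<close>.
  Conversely, \<open>P\<close> maps the open set \<open>K - S\<close> onto an open subset of
  \<open>K\<close>, which contains no limit of points outside \<open>K\<close>.\<close>

lemma poly_in_S_iff: "poly P z \<in> S \<longleftrightarrow> z \<in> S"
proof
  assume "z \<in> S"
  then obtain w where w: "cmod w = 1" "z = \<Phi> w" by auto
  then have "poly P z = \<Phi> (w ^ degree P)" by (simp add: poly_\<Phi>)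
  then show "poly P z \<in> S" using w by (simp add: norm_power)
next
  assume Pz: "poly P z \<in> S"
  show "z \<in> S"
  proof (rule ccontr)
    assume "z \<notin> S"
    have "z \<in> K" using Pz S_subset_K poly_in_filled_julia_iff by blast
    then have z: "z \<in> K - S" using \<open>z \<notin> S\<close> by blast
    have nc: "\<not> poly P constant_on X" if X: "open X" "X \<noteq> {}" for X
    proof
      assume "poly P constant_on X"
      then obtain y where "X \<subseteq> {x. poly (P - [:y:]) x = 0}" unfolding constant_on_def by auto
      moreover have "P - [:y:] \<noteq> 0" using degree_ge_2 by auto
      ultimately have "finite X" using poly_roots_finite finite_subset by blast
      then show False using X finite_imp_not_open by blast
    qed
    have "open (poly P ` (K - S))"
      by (rule open_mapping_thm2[of _ "K - S"]) (use nc open_K_minus_S in \<open>auto intro!: holomorphic_intros\<close>)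
    moreover have "poly P ` (K - S) \<subseteq> K" using poly_in_filled_julia_iff by blast
    ultimately have "poly P ` (K - S) \<inter> closure (- K) = {}"
      by (metis Int_commute disjoint_eq_subset_Compl double_complement open_Int_closure_eq_empty)
    then show False using z Pz unfolding S_eq by blast
  qed
qed

end

section \<open>The chordal metric\<close>

text \<open>Inverse stereographic projection onto the unit sphere of three-space, with infinity at
  the north pole. The chordal metric is the Euclidean distance of the images, which yields the
  triangle inequality.\<close>

fun stereographic :: "complex option \<Rightarrow> complex \<times> real" where
  "stereographic (Some z) = ((2 / (1 + (cmod z)\<^sup>2)) *\<^sub>R z, 1 - 2 / (1 + (cmod z)\<^sup>2))"
| "stereographic None = (0, 1)"

lemma norm_scaleR_diff_squared:
  fixes z w :: "'a::real_inner"
  shows "(norm (a *\<^sub>R z - b *\<^sub>R w))\<^sup>2 = a\<^sup>2 * (norm z)\<^sup>2 + b\<^sup>2 * (norm w)\<^sup>2 - 2 * a * b * (z \<bullet> w)"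
  unfolding power2_norm_eq_inner
  by (simp add: inner_diff_left inner_diff_right inner_commute power2_eq_square algebra_simps)

text \<open>The squared distance of two projected points, where \<open>m\<close> and
  \<open>n\<close> stand for the squared moduli and \<open>t\<close> for the inner product.\<close>

lemma stereographic_identity:
  fixes m n t :: real
  assumes "m \<ge> 0" "n \<ge> 0"
  shows "(2 / (1 + m))\<^sup>2 * m + (2 / (1 + n))\<^sup>2 * n - 2 * (2 / (1 + m)) * (2 / (1 + n)) * t
     + ((1 - 2 / (1 + m)) - (1 - 2 / (1 + n)))\<^sup>2 = 4 * (m + n - 2 * t) / ((1 + m) * (1 + n))"
proof -
  have "1 + m \<noteq> 0" "1 + n \<noteq> 0" using assms by auto
  then show ?thesis by (simp add: divide_simps power2_eq_square) (simp add: algebra_simps)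
qed

lemma chordal_commute: "chordal x y = chordal y x"
  by (cases x; cases y) (simp_all add: norm_minus_commute mult.commute)

lemma dist_stereographic: "dist (stereographic x) (stereographic y) = chordal x y"
proof -
  have finite: "dist (stereographic (Some z)) (stereographic (Some w)) = chordal (Some z) (Some w)" for z w
  proof -
    let ?m = "(cmod z)\<^sup>2" and ?n = "(cmod w)\<^sup>2"
    have zw: "(cmod (z - w))\<^sup>2 = ?m + ?n - 2 * (z \<bullet> w)"
      using norm_scaleR_diff_squared[of 1 z 1 w] by simp
    have "dist (stereographic (Some z)) (stereographic (Some w)) =
        sqrt (4 * (cmod (z - w))\<^sup>2 / ((1 + ?m) * (1 + ?n)))"
      unfolding zw using stereographic_identity[of ?m ?n "z \<bullet> w"]
      by (simp add: dist_prod_def dist_norm norm_scaleR_diff_squared)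
    also have "\<dots> = chordal (Some z) (Some w)"
      by (simp add: real_sqrt_divide real_sqrt_mult)
    finally show ?thesis .
  qed
  have infinite: "dist (stereographic (Some z)) (stereographic None) = chordal (Some z) None" for z
  proof -
    let ?A = "1 + (cmod z)\<^sup>2"
    have A: "?A > 0" by (simp add: add_pos_nonneg)
    have "dist (stereographic (Some z)) (stereographic None) = sqrt ((2 / ?A)\<^sup>2 * (cmod z)\<^sup>2 + (2 / ?A)\<^sup>2)"
      by (simp add: dist_prod_def dist_norm power_mult_distrib power_divide)
    also have "(2 / ?A)\<^sup>2 * (cmod z)\<^sup>2 + (2 / ?A)\<^sup>2 = (2 / ?A)\<^sup>2 * ?A"
      by (simp add: algebra_simps)
    also have "\<dots> = 4 / ?A"
    proof -
      have "(2 / a)\<^sup>2 * a = 4 / a" if "a > 0" for a :: real using that by (simp add: power2_eq_square)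
      then show ?thesis using A .
    qed
    finally show ?thesis by (simp add: real_sqrt_divide)
  qed
  show ?thesis
    by (cases x; cases y) (use finite infinite in \<open>simp_all add: dist_commute chordal_commute del: stereographic.simps chordal.simps\<close>, simp)
qed

lemma Metric_space_chordal: "Metric_space UNIV chordal"
proof -
  have inj: "stereographic x = stereographic y \<Longrightarrow> x = y" for x y
  proof (cases x; cases y)
    fix z w assume *: "x = Some z" "y = Some w" and "stereographic x = stereographic y"
    then have "2 / (1 + (cmod z)\<^sup>2) = 2 / (1 + (cmod w)\<^sup>2)"
      "(2 / (1 + (cmod z)\<^sup>2)) *\<^sub>R z = (2 / (1 + (cmod w)\<^sup>2)) *\<^sub>R w" by auto
    moreover have "2 / (1 + (cmod z)\<^sup>2) \<noteq> 0" by (smt (verit) divide_eq_0_iff zero_le_power2)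
    ultimately show "x = y" using * by (metis scaleR_cancel_left)
  qed (auto simp: add_nonneg_eq_0_iff)
  show ?thesis
    by unfold_locales
      (use inj in \<open>auto simp: dist_stereographic[symmetric] dist_commute dist_triangle\<close>)
qed

section \<open>Matings\<close>

lemma cmod_exp_circle: "cmod (exp (2 * pi * \<i> * complex_of_real t)) = 1"
  using norm_exp_i_times[of "2 * pi * t"] by (simp add: mult_ac)

lemma unit_circle_exp:
  assumes "cmod \<zeta> = 1"
  obtains t where "\<zeta> = exp (2 * pi * \<i> * complex_of_real t)"
proof -
  obtain s where "\<zeta> = exp (\<i> * complex_of_real s)"
    using assms complex_norm_eq_1_exp by (metis mult.commute)
  then have "\<zeta> = exp (2 * pi * \<i> * complex_of_real (s / (2 * pi)))" by (simp add: mult.commute)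
  then show ?thesis by (rule that)
qed

lemma f_post: "v \<in> post f \<Longrightarrow> f v \<in> post f"
proof -
  assume "v \<in> post f"
  then obtain n c where "v = (f ^^ n) c" "critical_point f c" "n \<ge> 1" by (auto simp: post_def)
  then have "f v = (f ^^ Suc n) c" "Suc n \<ge> 1" by auto
  then show ?thesis using \<open>critical_point f c\<close> unfolding post_def by blast
qed

lemma critical_value_in_post: "critical_point f c \<Longrightarrow> f c \<in> post f"
  unfolding post_def by (rule CollectI, rule exI[of _ 1], rule exI[of _ c]) simp

locale mating =
  fixes f :: "complex option \<Rightarrow> complex option" and Pw Pb :: "complex poly"
    and \<Phi>w \<Phi>b :: "complex \<Rightarrow> complex" and \<pi> :: "bool \<times> complex \<Rightarrow> complex option"
  assumes white: "boettcher Pw \<Phi>w" and black: "boettcher Pb \<Phi>b"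
    and degree_eq: "degree Pw = degree Pb"
    and quotient: "quotient_map (mating_top Pw Pb) sphere_top \<pi>"
    and fibres: "\<And>x y. x \<in> mating_space Pw Pb \<Longrightarrow> y \<in> mating_space Pw Pb \<Longrightarrow>
        \<pi> x = \<pi> y \<longleftrightarrow> (x, y) \<in> mating_rel Pw Pb \<Phi>w \<Phi>b"
    and semiconj: "\<And>x. x \<in> mating_space Pw Pb \<Longrightarrow> \<pi> (mating_map Pw Pb x) = f (\<pi> x)"
begin

definition P where "P i = (if i then Pw else Pb)"
definition S where "S i = (if i then \<Phi>w else \<Phi>b) ` sphere 0 1"
text \<open>The interior of the filled Julia set, as \<open>S i\<close> is its boundary.\<close>

definition I where "I i = filled_julia (P i) - S i"

text \<open>Parametrised by white angles; the gluing makes it run through the image of the black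
  Julia set as well, in the opposite direction.\<close>

definition \<gamma> :: "real \<Rightarrow> complex option" where "\<gamma> t = \<pi> (True, boundary_param \<Phi>w t)"

lemma mating_space_iff: "(i, z) \<in> mating_space Pw Pb \<longleftrightarrow> z \<in> filled_julia (P i)"
  by (auto simp: mating_space_def P_def)

lemma boettcher_P: "boettcher (P i) (if i then \<Phi>w else \<Phi>b)"
  using white black by (simp add: P_def)

lemma degree_P: "degree (P i) = degree Pw"
  using degree_eq by (simp add: P_def)

lemma degree_ge_2: "degree Pw \<ge> 2"
  using white by (rule boettcher.degree_ge_2)

lemma S_subset: "S i \<subseteq> filled_julia (P i)"
  unfolding S_def by (rule boettcher.S_subset_K[OF boettcher_P])

lemma P_in_S_iff: "poly (P i) z \<in> S i \<longleftrightarrow> z \<in> S i"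
  unfolding S_def by (rule boettcher.poly_in_S_iff[OF boettcher_P])

lemma open_I: "open (I i)"
  unfolding I_def S_def by (rule boettcher.open_K_minus_S[OF boettcher_P])

lemma P_in_I_iff: "poly (P i) z \<in> I i \<longleftrightarrow> z \<in> I i"
  by (simp add: I_def P_in_S_iff poly_in_filled_julia_iff)

lemma semiconj': "z \<in> filled_julia (P i) \<Longrightarrow> f (\<pi> (i, z)) = \<pi> (i, poly (P i) z)"
  using semiconj[of "(i, z)"] by (simp add: mating_space_iff mating_map_def P_def)

lemma surj: "\<exists>i z. z \<in> filled_julia (P i) \<and> v = \<pi> (i, z)"
proof -
  have "\<pi> ` topspace (mating_top Pw Pb) = UNIV"
    using quotient_imp_surjective_map[OF quotient]
    by (simp add: sphere_top_def Metric_space.topspace_mtopology[OF Metric_space_chordal])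
  then obtain x where "x \<in> topspace (mating_top Pw Pb)" "v = \<pi> x" by blast
  then show ?thesis
    unfolding mating_top_def P_def by (cases x) (simp, metis)
qed

section \<open>Identifications made by the quotient map\<close>

lemma boundary_param_in_S: "boundary_param \<Phi>w t \<in> S True" "boundary_param \<Phi>b t \<in> S False"
  unfolding boundary_param_def S_def using cmod_exp_circle by auto

text \<open>A chain of gluings has a first step, and every gluing starts at a boundary
  point.\<close>

lemma mating_rel_outside:
  assumes "((i, z), y) \<in> mating_rel Pw Pb \<Phi>w \<Phi>b" "z \<notin> S i"
  shows "y = (i, z)"
proof -
  define R where "R = {((True, boundary_param \<Phi>w t), (False, boundary_param \<Phi>b (- t))) | t. True}"
  have "((i, z), y) \<in> Id_on (mating_space Pw Pb) \<union> (R \<union> R\<inverse>)\<^sup>+"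
    using assms(1) unfolding mating_rel_def Let_def R_def .
  moreover have "((i, z), y) \<notin> (R \<union> R\<inverse>)\<^sup>+"
  proof
    assume "((i, z), y) \<in> (R \<union> R\<inverse>)\<^sup>+"
    then obtain w where "((i, z), w) \<in> R \<union> R\<inverse>" by (metis tranclD)
    then show False using assms(2) boundary_param_in_S by (auto simp: R_def)
  qed
  ultimately show ?thesis by auto
qed

lemma \<pi>_eq_interior:
  assumes "\<pi> (i, z) = \<pi> (j, w)" "z \<in> I i" "w \<in> filled_julia (P j)"
  shows "i = j \<and> z = w"
proof -
  have "((i, z), (j, w)) \<in> mating_rel Pw Pb \<Phi>w \<Phi>b"
    using fibres[of "(i, z)" "(j, w)"] assms by (simp add: mating_space_iff I_def)
  then show ?thesis using mating_rel_outside[of i z "(j, w)"] assms(2) by (auto simp: I_def)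
qed

lemma S_in_curve:
  assumes "z \<in> S i"
  shows "\<exists>t. \<pi> (i, z) = \<gamma> t"
proof (cases i)
  case True
  then obtain \<zeta> where \<zeta>: "cmod \<zeta> = 1" "z = \<Phi>w \<zeta>" using assms by (auto simp: S_def)
  then show ?thesis using True unit_circle_exp[OF \<zeta>(1)] unfolding \<gamma>_def boundary_param_def by metis
next
  case False
  then obtain \<zeta> where \<zeta>: "cmod \<zeta> = 1" "z = \<Phi>b \<zeta>" using assms by (auto simp: S_def)
  obtain t where t: "z = boundary_param \<Phi>b t"
    using unit_circle_exp[OF \<zeta>(1)] \<zeta>(2) unfolding boundary_param_def by metis
  \<comment> \<open>The gluing reverses angles, so the black angle \<open>t\<close> meets the white
    angle \<open>- t\<close>.\<close>
  have "((True, boundary_param \<Phi>w (- t)), (False, boundary_param \<Phi>b (- (- t)))) \<in> mating_rel Pw Pb \<Phi>w \<Phi>b"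
    unfolding mating_rel_def Let_def by blast
  then have "\<pi> (True, boundary_param \<Phi>w (- t)) = \<pi> (i, z)"
    using fibres[of "(True, boundary_param \<Phi>w (- t))" "(i, z)"] S_subset boundary_param_in_S False t
    by (auto simp: mating_space_iff)
  then show ?thesis by (metis \<gamma>_def)
qed

lemma curve_eq_interior: "\<gamma> t = \<pi> (i, z) \<Longrightarrow> z \<notin> I i"
  using \<pi>_eq_interior[of i z True "boundary_param \<Phi>w t"] boundary_param_in_S(1)[of t] subsetD[OF S_subset[of True]]
  by (metis DiffD2 I_def \<gamma>_def)

section \<open>The dynamics of \<open>f\<close> along the curve\<close>

lemma f_in_curve_iff: "f v \<in> range \<gamma> \<longleftrightarrow> v \<in> range \<gamma>"
proof -
  obtain i z where z: "z \<in> filled_julia (P i)" "v = \<pi> (i, z)" using surj by blast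
  \<comment> \<open>Interior points are not glued to the curve, so membership can be tested on the
    polynomial side, where \<open>S i\<close> is totally invariant.\<close>
  have *: "\<pi> (i, w) \<in> range \<gamma> \<longleftrightarrow> w \<in> S i" if "w \<in> filled_julia (P i)" for w
    using S_in_curve[of w i] curve_eq_interior[of _ i w] that by (auto simp: I_def)
  show ?thesis
    using *[OF z(1)] *[of "poly (P i) z"] z semiconj'[OF z(1)] P_in_S_iff poly_in_filled_julia_iff
    by metis
qed

lemma funpow_in_curve_iff: "(f ^^ n) v \<in> range \<gamma> \<longleftrightarrow> v \<in> range \<gamma>"
  by (induction n) (simp_all add: f_in_curve_iff)

text \<open>By the functional equation the polynomial acts as a power map on the circle, which
  multiplies angles by the degree.\<close>

lemma f_curve: "f (\<gamma> t) = \<gamma> (real (degree Pw) * t)"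
proof -
  let ?\<zeta> = "exp (2 * pi * \<i> * complex_of_real t)"
  have "poly Pw (boundary_param \<Phi>w t) = \<Phi>w (?\<zeta> ^ degree Pw)"
    unfolding boundary_param_def by (rule boettcher.poly_\<Phi>[OF white]) (simp add: cmod_exp_circle)
  also have "?\<zeta> ^ degree Pw = exp (2 * pi * \<i> * complex_of_real (real (degree Pw) * t))"
    by (simp add: exp_of_nat_mult[symmetric] mult_ac)
  finally have "poly Pw (boundary_param \<Phi>w t) = boundary_param \<Phi>w (real (degree Pw) * t)"
    by (simp add: boundary_param_def)
  then show ?thesis
    using semiconj'[of "boundary_param \<Phi>w t" True] boundary_param_in_S(1)[of t] S_subset[of True]
    by (auto simp: \<gamma>_def P_def)
qed

lemma funpow_curve: "(f ^^ n) (\<gamma> t) = \<gamma> (real (degree Pw) ^ n * t)"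
  by (induction n) (simp_all add: f_curve mult.assoc)

lemma curve_periodic: "\<gamma> (t + of_int k) = \<gamma> t"
proof -
  have "exp (2 * pi * \<i> * complex_of_real (t + of_int k)) = exp (2 * pi * \<i> * complex_of_real t)"
    by (rule exp_eq[THEN iffD2], rule exI[of _ k]) (simp add: algebra_simps)
  then show ?thesis by (simp add: \<gamma>_def boundary_param_def)
qed

lemma continuous_curve: "continuous_map euclideanreal sphere_top \<gamma>"
proof -
  have "continuous_on UNIV (boundary_param \<Phi>w)"
    unfolding boundary_param_def
    by (rule continuous_on_compose2[OF boettcher.cont[OF white]])
      (auto intro!: continuous_intros simp: cmod_exp_circle)
  then have 1: "continuous_map euclideanreal (subtopology euclidean (filled_julia Pw)) (boundary_param \<Phi>w)"
    using boundary_param_in_S(1) S_subset[of True]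
    by (auto simp: continuous_map_in_subtopology P_def)
  have 2: "continuous_map (subtopology euclidean (filled_julia Pw)) (mating_top Pw Pb) (\<lambda>z. (True, z))"
    using continuous_map_component_injection[of True UNIV
        "\<lambda>i. subtopology euclidean (if i then filled_julia Pw else filled_julia Pb)"]
    by (simp add: mating_top_def)
  have "continuous_map euclideanreal sphere_top (\<pi> \<circ> ((\<lambda>z. (True, z)) \<circ> boundary_param \<Phi>w))"
    by (intro continuous_map_compose[OF continuous_map_compose[OF 1 2]] quotient_imp_continuous_map quotient)
  then show ?thesis by (simp add: \<gamma>_def[abs_def] o_def)
qed

text \<open>\<open>\<gamma>\<close> semiconjugates multiplication by the degree on the circle to \<open>f\<close>, so some iterate of \<open>f\<close>
  maps every small neighbourhood of \<open>\<gamma> t\<close> over the whole curve.\<close>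

lemma curve_in_fatou_imp_constant:
  assumes "\<gamma> t \<in> fatou_set f"
  shows "\<gamma> s = \<gamma> s'"
proof -
  interpret Metric_space UNIV chordal by (rule Metric_space_chordal)
  let ?d = "real (degree Pw)"
  \<comment> \<open>One \<open>n\<close> serves all \<open>s\<close>, so the whole curve lies within
    \<open>e\<close> of a single point.\<close>
  have small: "\<exists>n. \<forall>s. chordal ((f ^^ n) (\<gamma> t)) (\<gamma> s) < e" if "e > 0" for e
  proof -
    obtain \<delta> where \<delta>: "\<delta> > 0" "\<And>w n. chordal (\<gamma> t) w < \<delta> \<Longrightarrow> chordal ((f ^^ n) (\<gamma> t)) ((f ^^ n) w) < e"
      using assms \<open>e > 0\<close> unfolding fatou_set_def by blast
    have "openin euclideanreal {s \<in> topspace euclideanreal. \<gamma> s \<in> mball (\<gamma> t) \<delta>}"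
      using continuous_curve unfolding sphere_top_def
      by (rule openin_continuous_map_preimage) simp
    then have "open {s. chordal (\<gamma> t) (\<gamma> s) < \<delta>}" by simp
    moreover have "t \<in> {s. chordal (\<gamma> t) (\<gamma> s) < \<delta>}" using \<delta>(1) by simp
    ultimately obtain \<epsilon> where \<epsilon>: "\<epsilon> > 0" "\<And>s. dist s t < \<epsilon> \<Longrightarrow> chordal (\<gamma> t) (\<gamma> s) < \<delta>"
      unfolding open_dist by blast
    \<comment> \<open>This \<open>n\<close> stretches a parameter interval of length
      \<open>\<epsilon>\<close> to more than one full turn.\<close>
    obtain n where n: "1 / \<epsilon> < ?d ^ n"
      using real_arch_pow[of ?d "1 / \<epsilon>"] degree_ge_2 by auto
    have dn: "?d ^ n > 0" using degree_ge_2 by simp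
    have "chordal ((f ^^ n) (\<gamma> t)) (\<gamma> s) < e" for s
    proof -
      \<comment> \<open>With this ceiling, \<open>u\<close> is the first parameter from
        \<open>t\<close> on for which \<open>?d ^ n * u\<close> agrees with \<open>s\<close> modulo
        1; it is less than \<open>1 / ?d ^ n\<close> away from \<open>t\<close>.\<close>
      define k where "k = \<lceil>?d ^ n * t - s\<rceil>"
      define u where "u = (s + of_int k) / ?d ^ n"
      have "0 \<le> s + of_int k - ?d ^ n * t" "s + of_int k - ?d ^ n * t < 1"
        unfolding k_def by linarith+
      moreover have "s + of_int k - ?d ^ n * t = (u - t) * ?d ^ n"
        unfolding u_def using dn by (simp add: field_simps)
      ultimately have "0 \<le> (u - t) * ?d ^ n" "(u - t) * ?d ^ n < 1" by auto
      then have "0 \<le> u - t" "u - t < 1 / ?d ^ n" using dn by (simp_all add: zero_le_mult_iff field_simps)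
      moreover have "1 / ?d ^ n < \<epsilon>" using n dn \<epsilon>(1) by (simp add: field_simps)
      ultimately have "dist u t < \<epsilon>" by (simp add: dist_real_def)
      then have "chordal ((f ^^ n) (\<gamma> t)) ((f ^^ n) (\<gamma> u)) < e" by (intro \<delta>(2) \<epsilon>(2))
      moreover have "(f ^^ n) (\<gamma> u) = \<gamma> s"
        using curve_periodic[of s k] dn by (simp add: funpow_curve u_def)
      ultimately show ?thesis by simp
    qed
    then show ?thesis by blast
  qed
  have "chordal (\<gamma> s) (\<gamma> s') \<le> 0 + e" if "e > 0" for e
  proof -
    obtain n where "\<And>s. chordal ((f ^^ n) (\<gamma> t)) (\<gamma> s) < e / 2" using small[of "e / 2"] \<open>e > 0\<close> by auto
    from this[of s] this[of s'] show ?thesis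
      using triangle[of "\<gamma> s" "(f ^^ n) (\<gamma> t)" "\<gamma> s'"] commute[of "\<gamma> s" "(f ^^ n) (\<gamma> t)"] by simp
  qed
  then have "chordal (\<gamma> s) (\<gamma> s') \<le> 0" by (rule field_le_epsilon)
  then show ?thesis using nonneg[of "\<gamma> s" "\<gamma> s'"] zero[of "\<gamma> s" "\<gamma> s'"] by simp
qed

text \<open>A curve reduced to one point would be a totally invariant point by
  \<open>f_in_curve_iff\<close>.\<close>

lemma curve_disjoint_fatou:
  assumes "\<not> is_polynomial_like f"
  shows "\<gamma> t \<notin> fatou_set f"
proof
  assume "\<gamma> t \<in> fatou_set f"
  then have "range \<gamma> = {\<gamma> t}" using curve_in_fatou_imp_constant by blast
  then have "f -` {\<gamma> t} = {\<gamma> t}" using f_in_curve_iff by auto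
  then show False using assms by (auto simp: is_polynomial_like_def)
qed

text \<open>Hyperbolicity puts the critical points in the Fatou set, hence off the curve, and their
  orbits stay off it.\<close>

lemma post_in_interior:
  assumes "\<not> is_polynomial_like f" "hyperbolic f" "v \<in> post f"
  shows "\<exists>i z. z \<in> I i \<and> v = \<pi> (i, z)"
proof -
  obtain n c where c: "v = (f ^^ n) c" "critical_point f c" using assms(3) by (auto simp: post_def)
  then have "c \<in> fatou_set f" using assms(2) by (simp add: hyperbolic_def)
  then have "c \<notin> range \<gamma>" using curve_disjoint_fatou[OF assms(1)] by auto
  then have "v \<notin> range \<gamma>" using c funpow_in_curve_iff by simp
  moreover obtain i z where "z \<in> filled_julia (P i)" "v = \<pi> (i, z)" using surj by blast
  ultimately show ?thesis using S_in_curve[of z i] by (auto simp: I_def)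
qed

section \<open>Fibres of \<open>f\<close> over interior points\<close>

lemma vimage_interior:
  assumes "z \<in> I i"
  shows "f -` {\<pi> (i, z)} = (\<lambda>w. \<pi> (i, w)) ` {w. poly (P i) w = z}"
proof (intro set_eqI iffI)
  fix y assume "y \<in> f -` {\<pi> (i, z)}"
  moreover obtain j w where w: "w \<in> filled_julia (P j)" "y = \<pi> (j, w)" using surj by blast
  ultimately have "\<pi> (i, z) = \<pi> (j, poly (P j) w)" using semiconj'[OF w(1)] by simp
  \<comment> \<open>An interior point is glued to nothing else, so its preimages all have its
    colour.\<close>
  then have "i = j \<and> z = poly (P j) w"
    using \<pi>_eq_interior[OF _ assms] poly_in_filled_julia_iff w(1) by blast
  then show "y \<in> (\<lambda>w. \<pi> (i, w)) ` {w. poly (P i) w = z}" using w(2) by auto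
next
  fix y assume "y \<in> (\<lambda>w. \<pi> (i, w)) ` {w. poly (P i) w = z}"
  then obtain w where w: "y = \<pi> (i, w)" "poly (P i) w = z" by blast
  then have "w \<in> filled_julia (P i)" using assms P_in_I_iff[of i w] by (auto simp: I_def)
  then show "y \<in> f -` {\<pi> (i, z)}" using semiconj' w by simp
qed

lemma inj_on_interior: "inj_on (\<lambda>w. \<pi> (i, w)) (I i)"
proof (rule inj_onI)
  fix z w assume "z \<in> I i" "w \<in> I i" "\<pi> (i, z) = \<pi> (i, w)"
  then show "z = w" using \<pi>_eq_interior[of i z i w] by (simp add: I_def)
qed

lemma card_vimage_interior:
  assumes "z \<in> I i"
  shows "card (f -` {\<pi> (i, z)}) = card {w. poly (P i) w = z}"
  unfolding vimage_interior[OF assms]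
  by (rule card_image, rule inj_on_subset[OF inj_on_interior]) (use assms P_in_I_iff in blast)

section \<open>Counting the postcritical points of each colour\<close>

lemma card_post_neq_3:
  assumes rat: "rational_map_of_degree f d" and d2: "d \<ge> 2" and hyp: "hyperbolic f"
    and fin: "finite (post f)" and npoly: "\<not> is_polynomial_like f"
  shows "card (post f) \<noteq> 3"
proof
  assume c3: "card (post f) = 3"
  obtain p q where pq: "q \<noteq> 0" "coprime p q" "max (degree p) (degree q) = d" and f: "f = rat_eval p q"
    using rat by (auto simp: rational_map_of_degree_def)
  have "d \<ge> 1" using d2 by simp
  have "rat_eval p q c \<in> post f" if "critical_point (rat_eval p q) c" for c
    using critical_value_in_post[of f c] that unfolding f by blast
  note rh = riemann_hurwitz_le[OF pq \<open>d \<ge> 1\<close> fin this, folded f]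
  \<comment> \<open>The postcritical points of each colour, in the plane of the polynomial
    (\<open>A\<close>) and on the sphere (\<open>V\<close>).\<close>
  define A where "A i = {z \<in> I i. \<pi> (i, z) \<in> post f}" for i
  define V where "V i = (\<lambda>z. \<pi> (i, z)) ` A i" for i
  have inj: "inj_on (\<lambda>z. \<pi> (i, z)) (A i)" for i
    using inj_on_interior by (rule inj_on_subset) (auto simp: A_def)
  have VV: "post f = V True \<union> V False"
  proof
    show "post f \<subseteq> V True \<union> V False"
    proof
      fix v assume v: "v \<in> post f"
      then obtain i z where "z \<in> I i" "v = \<pi> (i, z)" using post_in_interior[OF npoly hyp] by blast
      then have "v \<in> V i" using v by (auto simp: V_def A_def)
      then show "v \<in> V True \<union> V False" by (cases i) auto
    qed
  qed (auto simp: V_def A_def)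
  have disj: "V True \<inter> V False = {}"
    using \<pi>_eq_interior[of True _ False] by (auto simp: V_def A_def I_def)
  have finV: "finite (V i)" for i using fin unfolding VV by (cases i) auto
  then have finA: "finite (A i)" for i unfolding V_def using finite_image_iff[OF inj] by blast
  have cardV: "card (V i) = card (A i)" for i unfolding V_def by (rule card_image[OF inj])
  have c3': "card (A True) + card (A False) = 3"
    using card_Un_disjoint[OF finV finV disj] c3 by (simp add: VV[symmetric] cardV)
  \<comment> \<open>The degrees are compared on the fibre over a generic interior point, which
    exists because some \<open>I j\<close> is open and nonempty.\<close>
  have deg: "degree (P i) = d" for i
  proof -
    have "\<exists>j. A j \<noteq> {}" using c3' by (metis add.left_neutral card.empty zero_neq_numeral)
    then obtain j where "I j \<noteq> {}" by (auto simp: A_def)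
    then have inf: "infinite (I j)" using open_I finite_imp_not_open by blast
    have "pderiv (P j) \<noteq> 0" using degree_P[of j] degree_ge_2 by (auto simp: pderiv_eq_0_iff)
    then have "finite (poly (P j) ` {z. poly (pderiv (P j)) z = 0})" (is "finite ?C")
      by (intro finite_imageI poly_roots_finite)
    moreover have "finite {z \<in> I j. \<pi> (j, z) = f None}" (is "finite ?N")
    proof (rule inj_on_finite)
      show "inj_on (\<lambda>z. \<pi> (j, z)) ?N" using inj_on_interior by (rule inj_on_subset) auto
      show "(\<lambda>z. \<pi> (j, z)) ` ?N \<subseteq> {f None}" by auto
    qed simp
    \<comment> \<open>Off the critical values of \<open>P j\<close>, the point over
      \<open>f None\<close> and the postcritical points, both maps have full fibres.\<close>
    ultimately have "finite (?C \<union> ?N \<union> A j)" using finA by simp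
    then have "\<not> I j \<subseteq> ?C \<union> ?N \<union> A j" using inf finite_subset by blast
    then obtain z where z: "z \<in> I j" "z \<notin> ?C" "z \<notin> ?N" "z \<notin> A j" by blast
    have "card {w. poly (P j) w = z} = degree (P j)"
      by (rule card_poly_fibre_generic) (use z(2) degree_P[of j] degree_ge_2 in auto)
    moreover have "card (f -` {\<pi> (j, z)}) = d"
      by (rule rh(2)) (use z in \<open>auto simp: A_def\<close>)
    ultimately show ?thesis using card_vimage_interior[OF z(1)] degree_P by simp
  qed
  define s where "s i = (\<Sum>z\<in>A i. card {w. poly (P i) w = z})" for i
  have sV: "(\<Sum>v\<in>V i. card (f -` {v})) = s i" for i
  proof -
    have "(\<Sum>v\<in>V i. card (f -` {v})) = (\<Sum>z\<in>A i. card (f -` {\<pi> (i, z)}))"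
      unfolding V_def by (simp add: sum.reindex[OF inj])
    also have "\<dots> = s i"
      unfolding s_def by (rule sum.cong) (auto simp: A_def card_vimage_interior)
    finally show ?thesis .
  qed
  have total: "s True + s False + (2 * d - 2) \<le> (card (A True) + card (A False)) * d"
    using rh(1) sum.union_disjoint[OF finV finV disj, of "\<lambda>v. card (f -` {v})"]
      card_Un_disjoint[OF finV finV disj]
    unfolding VV by (simp add: sV cardV)
  have upper: "card (A i) * d \<le> s i + (d - 1)" for i
    using card_poly_fibres_ge[of "P i" "A i"] finA d2 unfolding s_def deg by simp
  \<comment> \<open>The two bounds allow \<open>2 * d - 2\<close> missing preimages in all, which is
    what \<open>total\<close> demands, so both are sharp.\<close>
  have eq: "card (A i) * d = s i + (d - 1)" for i
    using upper[of True] upper[of False] total d2 by (cases i) (simp_all add: algebra_simps)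
  \<comment> \<open>For an empty \<open>A i\<close> the equation would read
    \<open>0 = d - 1\<close>.\<close>
  have "card (A i) \<noteq> 0" for i
    using eq[of i] d2 by (cases "card (A i) = 0") auto
  then have "card (A True) \<ge> 1" "card (A False) \<ge> 1" by (simp_all add: Suc_le_eq)
  then have "card (A True) = 1 \<or> card (A False) = 1" using c3' by linarith
  then obtain i a where A1: "A i = {a}" by (auto simp: card_1_singleton_iff)
  then have a: "a \<in> I i" "\<pi> (i, a) \<in> post f" by (auto simp: A_def)
  then have "f (\<pi> (i, a)) = \<pi> (i, poly (P i) a)" by (intro semiconj') (simp add: I_def)
  \<comment> \<open>\<open>f\<close> preserves both the colour and the postcritical set, so the only
    postcritical point of this colour is fixed.\<close>
  then have "poly (P i) a \<in> A i" using f_post[OF a(2)] P_in_I_iff a(1) by (simp add: A_def)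
  then have Pa: "poly (P i) a = a" using A1 by simp
  \<comment> \<open>For a single point the equation reads \<open>d = s i + (d - 1)\<close>.\<close>
  have "card {w. poly (P i) w = a} = 1"
    using eq[of i] d2 unfolding s_def A1 by simp
  then obtain b where "{w. poly (P i) w = a} = {b}" by (rule card_1_singletonE)
  moreover have "a \<in> {w. poly (P i) w = a}" using Pa by simp
  ultimately have "{w. poly (P i) w = a} = {a}" by simp
  then have "f -` {\<pi> (i, a)} = {\<pi> (i, a)}" using vimage_interior[OF a(1)] by simp
  then show False using npoly unfolding is_polynomial_like_def by blast
qed

end

theorem theorem4p7:
  fixes f :: "complex option \<Rightarrow> complex option" and d :: nat
  assumes "rational_map_of_degree f d" and "d \<ge> 2"
    and "hyperbolic f" and "postcritically_finite f" and "card (post f) = 3"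
    and "\<not> is_polynomial_like f"
  shows "\<not> arises_as_mating f"
proof
  assume "arises_as_mating f"
  then obtain Pw Pb \<Phi>w \<Phi>b \<pi> where "mating f Pw Pb \<Phi>w \<Phi>b \<pi>"
    unfolding arises_as_mating_def mating_def boettcher_def by metis
  then show False
    using mating.card_post_neq_3 assms unfolding postcritically_finite_def by blast
qed

end
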